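(* Let $(T,X)$ be any semiflow on a nonempty compact Hausdorff space $X$. Then: (1) If $(T,X)$ is minimal with $T$ abelian and such that $x\mapsto t^{-1}[x]$ is continuous for each $t\in T$, then $(T,X)$ is a.a. if and only if $(T,X)$ is an almost 1-1 extension of an equicontinuous invertible semiflow. (2) Let $(T,X)$ be an almost 1-1 extension of a minimal semiflow $(T,Y)$ via $\pi\colon X\to Y$. If $(T,X)$ is point-distal, then $\pi$ is 1-1 at every distal point of $(T,X)$, i.e. $\pi^{-1}[\pi(x)]=\{x\}$ for every distal point $x$ of $(T,X)$.
   Context: $T$ is a topological semigroup with identity $e$; phase spaces are nonempty compact Hausdorff. A semiflow $(T,X)$ is a jointly continuous map $T\times X\to X$, $(t,x)\mapsto tx$, with $ex=x$ and $t(sx)=(ts)x$. It is minimal if every orbit $Tx$ is dense, and invertible if each transition $x\mapsto tx$ is a bijection of $X$. For $t\in T$ with $tX=X$, $t^{-1}[x]=\{z: tz=x\}$, and $x\mapsto t^{-1}[x]$ is continuous if $x_n\to x$ implies $t^{-1}[x_n]\to t^{-1}[x]$ in the Hausdorff (hyperspace) topology. $x\in P_{aa}(T,X)$ (almost automorphic point) if for every net $\{t_n\}$ in $T$ and net $\{x_n'\}$ in $X$: $t_nx\to y$, $x_n'\to x'$ and $t_nx_n'=y$ for all $n$ imply $x=x'$. $(T,X)$ is a.a. if there is $x\in P_{aa}(T,X)$ with dense orbit. $(T,Y)$ is equicontinuous if for every $y\in Y$ and every entourage $\varepsilon$ of the uniformity of $Y$ there is an entourage $\delta$ such that $(y,y')\in\delta$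 implies $(ty,ty')\in\varepsilon$ for all $t\in T$. An epimorphism $\pi\colon(T,X)\to(T,Y)$ is a continuous surjection with $\pi(tx)=t\pi(x)$. If $(T,X)$, $(T,Y)$ are minimal and some fibre $\pi^{-1}[y]$ is a singleton, then $(T,X)$ is called an almost 1-1 extension of $(T,Y)$ (via $\pi$). $x,y$ are proximal if there is a net $\{t_n\}$ in $T$ with $\lim_n t_nx=\lim_n t_ny$; $x$ is a distal point if it is proximal only to itself within $\overline{Tx}$. $(T,X)$ is point-distal if it has a distal point with dense orbit. *)

theory Defs
  imports "HOL-Analysis.Analysis"
begin

text \<open>
  The acting semigroup is a type of class \<^class>\<open>topological_monoid_mult\<close> (no separation axiom, jointly
  continuous multiplication); phase spaces are abstract topologies, so that factors can be
  quantified over.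

  Nets are families indexed by a type carrying a proper filter (the tail filter, for a directed
  index set). A definition has to fix the index type; the types fixed below are large enough for
  nets over every index type to be covered, which is proved in
  \<open>almost_automorphic_point_net\<close>, \<open>proximal_net\<close> and \<open>fibre_continuous_net\<close>.
\<close>

definition semiflow :: "'x topology \<Rightarrow> ('t::topological_monoid_mult \<Rightarrow> 'x \<Rightarrow> 'x) \<Rightarrow> bool" where
  "semiflow X \<phi> \<longleftrightarrow>
     topspace X \<noteq> {} \<and> compact_space X \<and> Hausdorff_space X \<and>
     continuous_map (prod_topology euclidean X) X (\<lambda>(t, x). \<phi> t x) \<and>
     (\<forall>x\<in>topspace X. \<phi> 1 x = x) \<and>
     (\<forall>s t. \<forall>x\<in>topspace X. \<phi> t (\<phi> s x) = \<phi> (t * s) x)"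

definition orbit :: "('t \<Rightarrow> 'x \<Rightarrow> 'x) \<Rightarrow> 'x \<Rightarrow> 'x set" where
  "orbit \<phi> x = range (\<lambda>t. \<phi> t x)"

definition dense_orbit :: "'x topology \<Rightarrow> ('t \<Rightarrow> 'x \<Rightarrow> 'x) \<Rightarrow> 'x \<Rightarrow> bool" where
  "dense_orbit X \<phi> x \<longleftrightarrow> X closure_of (orbit \<phi> x) = topspace X"

definition minimal_flow :: "'x topology \<Rightarrow> ('t \<Rightarrow> 'x \<Rightarrow> 'x) \<Rightarrow> bool" where
  "minimal_flow X \<phi> \<longleftrightarrow> (\<forall>x\<in>topspace X. dense_orbit X \<phi> x)"

definition invertible_flow :: "'x topology \<Rightarrow> ('t \<Rightarrow> 'x \<Rightarrow> 'x) \<Rightarrow> bool" where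
  "invertible_flow X \<phi> \<longleftrightarrow> (\<forall>t. bij_betw (\<phi> t) (topspace X) (topspace X))"

text \<open>The unique compatible uniformity of a compact Hausdorff space consists of all
  neighbourhoods of the diagonal.\<close>

definition entourage :: "'x topology \<Rightarrow> ('x \<times> 'x) set \<Rightarrow> bool" where
  "entourage X E \<longleftrightarrow>
     E \<subseteq> topspace X \<times> topspace X \<and>
     (\<exists>U. openin (prod_topology X X) U \<and> (\<forall>x\<in>topspace X. (x, x) \<in> U) \<and> U \<subseteq> E)"

definition equicontinuous_flow :: "'x topology \<Rightarrow> ('t \<Rightarrow> 'x \<Rightarrow> 'x) \<Rightarrow> bool" where
  "equicontinuous_flow X \<phi> \<longleftrightarrow>
     (\<forall>x\<in>topspace X. \<forall>E. entourage X E \<longrightarrow>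
        (\<exists>D. entourage X D \<and> (\<forall>x'. (x, x') \<in> D \<longrightarrow> (\<forall>t. (\<phi> t x, \<phi> t x') \<in> E))))"

definition fibre :: "'x topology \<Rightarrow> ('x \<Rightarrow> 'y) \<Rightarrow> 'y \<Rightarrow> 'x set" where
  "fibre X f y = {z \<in> topspace X. f z = y}"

text \<open>Convergence in the Hausdorff uniformity on subsets. The entourages are closed under
  converse, so using the same \<open>E\<close> in both inclusions is no restriction.\<close>

definition hausdorff_limit :: "'x topology \<Rightarrow> ('i \<Rightarrow> 'x set) \<Rightarrow> 'x set \<Rightarrow> 'i filter \<Rightarrow> bool" where
  "hausdorff_limit X A L F \<longleftrightarrow>
     (\<forall>E. entourage X E \<longrightarrow> (\<forall>\<^sub>F n in F. A n \<subseteq> E `` L \<and> L \<subseteq> E `` A n))"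

text \<open>Continuity of \<open>x \<mapsto> f\<inverse>[x]\<close>. For a transition \<open>f\<close> of a minimal semiflow with abelian acting
  semigroup \<open>f\<close> is onto, so that all fibres involved are nonempty.\<close>

definition fibre_continuous :: "'x topology \<Rightarrow> ('x \<Rightarrow> 'x) \<Rightarrow> bool" where
  "fibre_continuous X f \<longleftrightarrow>
     (\<forall>(F :: 'x filter) u x.
        F \<noteq> bot \<and> (\<forall>n. u n \<in> topspace X) \<and> limitin X u x F \<longrightarrow>
        hausdorff_limit X (\<lambda>n. fibre X f (u n)) (fibre X f x) F)"

definition almost_automorphic_point :: "'x topology \<Rightarrow> ('t \<Rightarrow> 'x \<Rightarrow> 'x) \<Rightarrow> 'x \<Rightarrow> bool" where
  "almost_automorphic_point X \<phi> x \<longleftrightarrow>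
     x \<in> topspace X \<and>
     (\<forall>(F :: ('t \<times> 'x) filter) t u y x'.
        F \<noteq> bot \<and> (\<forall>n. u n \<in> topspace X) \<and>
        limitin X (\<lambda>n. \<phi> (t n) x) y F \<and> limitin X u x' F \<and> (\<forall>n. \<phi> (t n) (u n) = y)
        \<longrightarrow> x = x')"

definition almost_automorphic :: "'x topology \<Rightarrow> ('t \<Rightarrow> 'x \<Rightarrow> 'x) \<Rightarrow> bool" where
  "almost_automorphic X \<phi> \<longleftrightarrow> (\<exists>x. almost_automorphic_point X \<phi> x \<and> dense_orbit X \<phi> x)"

definition epimorphism ::
  "'x topology \<Rightarrow> ('t \<Rightarrow> 'x \<Rightarrow> 'x) \<Rightarrow> 'y topology \<Rightarrow> ('t \<Rightarrow> 'y \<Rightarrow> 'y) \<Rightarrow> ('x \<Rightarrow> 'y) \<Rightarrow> bool" where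
  "epimorphism X \<phi> Y \<psi> \<pi> \<longleftrightarrow>
     continuous_map X Y \<pi> \<and> \<pi> ` topspace X = topspace Y \<and>
     (\<forall>t. \<forall>x\<in>topspace X. \<pi> (\<phi> t x) = \<psi> t (\<pi> x))"

definition almost_one_one_extension ::
  "'x topology \<Rightarrow> ('t::topological_monoid_mult \<Rightarrow> 'x \<Rightarrow> 'x) \<Rightarrow>
   'y topology \<Rightarrow> ('t \<Rightarrow> 'y \<Rightarrow> 'y) \<Rightarrow> ('x \<Rightarrow> 'y) \<Rightarrow> bool" where
  "almost_one_one_extension X \<phi> Y \<psi> \<pi> \<longleftrightarrow>
     semiflow X \<phi> \<and> semiflow Y \<psi> \<and> minimal_flow X \<phi> \<and> minimal_flow Y \<psi> \<and>
     epimorphism X \<phi> Y \<psi> \<pi> \<and> (\<exists>y\<in>topspace Y. \<exists>x. fibre X \<pi> y = {x})"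

definition proximal :: "'x topology \<Rightarrow> ('t \<Rightarrow> 'x \<Rightarrow> 'x) \<Rightarrow> 'x \<Rightarrow> 'x \<Rightarrow> bool" where
  "proximal X \<phi> x y \<longleftrightarrow>
     x \<in> topspace X \<and> y \<in> topspace X \<and>
     (\<exists>(F :: 't filter) t z. F \<noteq> bot \<and>
        limitin X (\<lambda>n. \<phi> (t n) x) z F \<and> limitin X (\<lambda>n. \<phi> (t n) y) z F)"

definition distal_point :: "'x topology \<Rightarrow> ('t \<Rightarrow> 'x \<Rightarrow> 'x) \<Rightarrow> 'x \<Rightarrow> bool" where
  "distal_point X \<phi> x \<longleftrightarrow>
     x \<in> topspace X \<and> (\<forall>y \<in> X closure_of (orbit \<phi> x). proximal X \<phi> x y \<longrightarrow> y = x)"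

definition point_distal :: "'x topology \<Rightarrow> ('t \<Rightarrow> 'x \<Rightarrow> 'x) \<Rightarrow> bool" where
  "point_distal X \<phi> \<longleftrightarrow> (\<exists>x. distal_point X \<phi> x \<and> dense_orbit X \<phi> x)"

lemma almost_automorphic_point_net:
  fixes F :: "'i filter"
  assumes aa: "almost_automorphic_point X \<phi> x" and F: "F \<noteq> bot"
    and u: "\<And>n. u n \<in> topspace X" and y: "limitin X (\<lambda>n. \<phi> (t n) x) y F"
    and x': "limitin X u x' F" and eq: "\<And>n. \<phi> (t n) (u n) = y"
  shows "x = x'"
proof -
  define p where "p = (\<lambda>n. (t n, u n))"
  define r where "r = (\<lambda>q. if q \<in> range p then q else p undefined)"
  have r: "r (p n) = p n" for n by (simp add: r_def)
  have "\<exists>n. r q = p n" for q by (auto simp: r_def)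
  then have "\<forall>q. snd (r q) \<in> topspace X \<and> \<phi> (fst (r q)) (snd (r q)) = y"
    by (metis u eq p_def fst_conv snd_conv)
  moreover have "filtermap p F \<noteq> bot" using F by (simp add: filtermap_bot_iff)
  moreover have "limitin X (\<lambda>q. \<phi> (fst (r q)) x) y (filtermap p F)"
    using y by (simp add: limitin_def eventually_filtermap r) (simp add: p_def)
  moreover have "limitin X (\<lambda>q. snd (r q)) x' (filtermap p F)"
    using x' by (simp add: limitin_def eventually_filtermap r) (simp add: p_def)
  ultimately show ?thesis
    using aa unfolding almost_automorphic_point_def
    by (elim conjE allE[of _ "filtermap p F"] allE[of _ "\<lambda>q. fst (r q)"]
        allE[of _ "\<lambda>q. snd (r q)"] allE[of _ y] allE[of _ x']) blast
qed

lemma proximal_net: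
  fixes F :: "'i filter"
  assumes "x \<in> topspace X" "y \<in> topspace X" and F: "F \<noteq> bot"
    and "limitin X (\<lambda>n. \<phi> (t n) x) z F" and "limitin X (\<lambda>n. \<phi> (t n) y) z F"
  shows "proximal X \<phi> x y"
proof -
  have "filtermap t F \<noteq> bot" using F by (simp add: filtermap_bot_iff)
  moreover have "limitin X (\<lambda>s. \<phi> (id s) x) z (filtermap t F)" "limitin X (\<lambda>s. \<phi> (id s) y) z (filtermap t F)"
    using assms by (simp_all add: limitin_def eventually_filtermap)
  ultimately show ?thesis
    using assms(1,2) unfolding proximal_def by blast
qed

lemma fibre_continuous_net:
  fixes F :: "'i filter"
  assumes f: "fibre_continuous X f" and F: "F \<noteq> bot"
    and u: "\<And>n. u n \<in> topspace X" and x: "limitin X u x F"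
  shows "hausdorff_limit X (\<lambda>n. fibre X f (u n)) (fibre X f x) F"
proof -
  define r where "r = (\<lambda>q. if q \<in> topspace X then q else u undefined)"
  have r: "r (u n) = u n" for n by (simp add: r_def u)
  have "filtermap u F \<noteq> bot" using F by (simp add: filtermap_bot_iff)
  moreover have "\<forall>q. r q \<in> topspace X" by (simp add: r_def u)
  moreover have "limitin X r x (filtermap u F)"
    using x by (simp add: limitin_def eventually_filtermap r)
  ultimately have "hausdorff_limit X (\<lambda>q. fibre X f (r q)) (fibre X f x) (filtermap u F)"
    using f unfolding fibre_continuous_def by blast
  then show ?thesis by (simp add: hausdorff_limit_def eventually_filtermap r)
qed

end

(*
  (2) If y has a one-point fibre {x0} and t_n (pi x) tends to y, then t_n z tends to x0 for every z in the
  fibre of x, so all points of that fibre are proximal to x.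

  (1) In an equicontinuous invertible flow the transitions are isometries for the pseudometrics
  sup_t |f(t y) - f(t y')|, so t_n y0 -> z = t_n u_n forces u_n -> y0; this transfers to the one-point
  fibre. Conversely, at an almost automorphic point x0 all transitions are homeomorphisms, and returns
  s x0, t x0 close enough to x0 have s^-1 t x0 close to x0. Hence the relations "some element of the group
  generated by T maps both points close to x0" form the base of an invariant uniformity coarser than that
  of X, and its separated quotient is the equicontinuous factor, with {x0} as a fibre.
*)

theory Submission
  imports Defs
begin

section \<open>Compact spaces and semiflows\<close>

text \<open>\<open>T\<close> has no inverses, so a fraction \<open>t^-1 s\<close> is expressed by an
  equation between translates, or by membership of \<open>\<phi> s x\<close> in the image of a set
  under \<open>\<phi> t\<close>. Such statements behave like statements about a group only once the
  transitions are bijective: almost automorphy gives injectivity over the orbit of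
  \<open>x0\<close>, and fibre continuity extends it to all of \<open>X\<close>. Almost automorphy
  controls \<open>x0\<close> alone. Density spreads this control: an open condition is tested on
  orbit points \<open>\<phi> k x0\<close>, where commutativity moves factors outward and injectivity
  cancels them. \<open>X\<close> need not be metrizable, yet a sequence suffices in the recurrence
  argument: its neighbourhoods need not form a base at \<open>x0\<close>, they only keep earlier
  failures alive, and cluster points supply the limits. For the equicontinuous factor,
  nonexpansiveness of the transitions is immediate. The obstacle is the reverse inequality, since
  the inverse of a transition need not belong to the flow; total boundedness supplies it.\<close>

lemma compact_space_pointwise_cover:
  assumes "compact_space X" and "\<And>x. x \<in> topspace X \<Longrightarrow> openin X (U x) \<and> x \<in> U x"
  obtains D where "finite D" "D \<subseteq> topspace X" "topspace X \<subseteq> \<Union>(U ` D)"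
proof -
  have "\<exists>\<F>. finite \<F> \<and> \<F> \<subseteq> U ` topspace X \<and> topspace X \<subseteq> \<Union>\<F>"
    using assms by (intro compactinD[of X]) (auto simp: compact_space_def)
  then show thesis using that by (metis finite_subset_image)
qed

lemma limitin_filter_mono:
  assumes "limitin X u x F" "G \<le> F"
  shows "limitin X u x G"
  using assms unfolding limitin_def by (meson filter_leD)

lemma limitin_filtercomap_nhdsin:
  assumes "x \<in> topspace X"
  shows "limitin X u x (filtercomap u (nhdsin X x))"
proof -
  have "eventually (\<lambda>n. u n \<in> U) (filtercomap u (nhdsin X x))" if "openin X U" "x \<in> U" for U
  proof -
    have "eventually (\<lambda>z. z \<in> U) (nhdsin X x)" using that by (auto simp: eventually_nhdsin)
    then show ?thesis by (rule eventually_filtercomapI)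
  qed
  with assms show ?thesis by (simp add: limitin_def)
qed

text \<open>Finer filters play the part of subnets: \<open>F\<close> is met with the pulled-back
  neighbourhood filter of a cluster point. Without a cluster point, a finite subcover would make
  \<open>F\<close> improper.\<close>

lemma compact_space_cluster:
  assumes X: "compact_space X" and F: "F \<noteq> bot" and u: "\<And>n. u n \<in> topspace X"
  obtains x G where "G \<noteq> bot" "G \<le> F" "limitin X u x G"
proof -
  have "\<exists>x\<in>topspace X. \<forall>U. openin X U \<and> x \<in> U \<longrightarrow> \<not> eventually (\<lambda>n. u n \<notin> U) F"
  proof (rule ccontr)
    assume "\<not> ?thesis"
    then have "\<forall>x\<in>topspace X. \<exists>U. openin X U \<and> x \<in> U \<and> eventually (\<lambda>n. u n \<notin> U) F" by blast
    then obtain U where U: "\<And>x. x \<in> topspace X \<Longrightarrow> openin X (U x) \<and> x \<in> U x \<and> eventually (\<lambda>n. u n \<notin> U x) F"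
      by metis
    obtain D where "finite D" "D \<subseteq> topspace X" "topspace X \<subseteq> \<Union>(U ` D)"
      using compact_space_pointwise_cover[OF X, of U] U by blast
    moreover from this have "eventually (\<lambda>n. \<forall>x\<in>D. u n \<notin> U x) F"
      using U by (intro eventually_ball_finite) auto
    ultimately have "eventually (\<lambda>n. False) F"
      using u by (elim eventually_mono) blast
    then show False using F by simp
  qed
  then obtain x where x: "x \<in> topspace X" "\<And>U. openin X U \<Longrightarrow> x \<in> U \<Longrightarrow> \<not> eventually (\<lambda>n. u n \<notin> U) F"
    by blast
  let ?G = "inf F (filtercomap u (nhdsin X x))"
  have "?G \<noteq> bot"
  proof
    assume "?G = bot"
    then obtain P Q where P: "eventually P F" and Q: "eventually Q (filtercomap u (nhdsin X x))"
      and PQ: "\<And>n. P n \<Longrightarrow> Q n \<Longrightarrow> False"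
      unfolding trivial_limit_def eventually_inf by blast
    obtain U where "openin X U" "x \<in> U" "\<And>n. u n \<in> U \<Longrightarrow> Q n"
      using Q x(1) unfolding eventually_filtercomap eventually_nhdsin by blast
    moreover from this have "eventually (\<lambda>n. u n \<notin> U) F"
      using P PQ by (blast intro: eventually_mono)
    ultimately show False using x(2) by blast
  qed
  moreover have "limitin X u x ?G"
    using limitin_filter_mono[OF limitin_filtercomap_nhdsin[OF x(1)]] by (metis inf_le2)
  ultimately show thesis using that by (metis inf_le1)
qed

text \<open>The index set itself, with the neighbourhood filter pulled back along \<open>f\<close>,
  is the net; it is proper because neighbourhoods of \<open>y\<close> meet the range.\<close>

lemma closure_of_range_net:
  assumes "y \<in> X closure_of range f"
  shows "filtercomap f (nhdsin X y) \<noteq> bot" "limitin X f y (filtercomap f (nhdsin X y))"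
proof -
  have y: "y \<in> topspace X" using assms by (simp add: in_closure_of)
  have meets: "\<exists>t. f t \<in> U" if "openin X U" "y \<in> U" for U
    using assms that unfolding in_closure_of by blast
  show "filtercomap f (nhdsin X y) \<noteq> bot"
    using meets y by (intro filtercomap_neq_bot) (auto simp: eventually_nhdsin)
  show "limitin X f y (filtercomap f (nhdsin X y))"
    using y by (rule limitin_filtercomap_nhdsin)
qed

lemma compact_Hausdorff_separating_function:
  assumes "compact_space X" "Hausdorff_space X" "x \<in> topspace X" "y \<in> topspace X" "x \<noteq> y"
  obtains f :: "_ \<Rightarrow> real" where "continuous_map X euclideanreal f" "f x \<noteq> f y"
proof -
  have "completely_regular_space X" "closedin X {y}"
    using assms by (simp_all add: compact_Hausdorff_or_regular_imp_normal_space
        normal_imp_completely_regular_space closedin_Hausdorff_singleton)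
  then obtain f :: "_ \<Rightarrow> real" where "continuous_map X (top_of_set {0..1}) f" "f x = 0" "f ` {y} \<subseteq> {1}"
    using assms unfolding completely_regular_space_def by (metis Diff_iff singletonD)
  then show thesis using that by (metis continuous_map_in_subtopology image_subset_iff insertI1 singletonD zero_neq_one)
qed

lemma semiflowD:
  assumes "semiflow X \<phi>"
  shows "compact_space X" "Hausdorff_space X"
    "continuous_map X X (\<phi> t)"
    "x \<in> topspace X \<Longrightarrow> \<phi> t x \<in> topspace X"
    "x \<in> topspace X \<Longrightarrow> \<phi> 1 x = x"
    "x \<in> topspace X \<Longrightarrow> \<phi> t (\<phi> s x) = \<phi> (t * s) x"
proof -
  show "compact_space X" "Hausdorff_space X"
    "x \<in> topspace X \<Longrightarrow> \<phi> 1 x = x"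
    "x \<in> topspace X \<Longrightarrow> \<phi> t (\<phi> s x) = \<phi> (t * s) x"
    using assms unfolding semiflow_def by simp_all
  have "continuous_map X X ((\<lambda>(t, x). \<phi> t x) \<circ> (\<lambda>x. (t, x)))"
    using assms unfolding semiflow_def
    by (intro continuous_map_compose[where X' = "prod_topology euclidean X"])
      (auto intro!: continuous_map_pairedI)
  then show c: "continuous_map X X (\<phi> t)" by (simp add: comp_def)
  then show "x \<in> topspace X \<Longrightarrow> \<phi> t x \<in> topspace X"
    by (simp add: continuous_map_def Pi_iff)
qed

lemma minimal_flow_closure:
  "minimal_flow X \<phi> \<Longrightarrow> x \<in> topspace X \<Longrightarrow> y \<in> topspace X \<Longrightarrow> y \<in> X closure_of range (\<lambda>t. \<phi> t x)"
  unfolding minimal_flow_def dense_orbit_def orbit_def by blast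

lemma minimal_flow_meets:
  assumes "minimal_flow X \<phi>" "x \<in> topspace X" "openin X U" "y \<in> U"
  obtains t where "\<phi> t x \<in> U"
  using minimal_flow_closure[OF assms(1,2)] assms(3,4) openin_subset[OF assms(3)]
  unfolding in_closure_of by blast

text \<open>\<open>f\<close> is closed, so every neighbourhood of the one-point fibre contains the
  full preimage of a neighbourhood of \<open>y\<close>. This lifts convergence from \<open>Y\<close>
  to \<open>X\<close>.\<close>

lemma limitin_singleton_fibre:
  assumes X: "compact_space X" and Y: "Hausdorff_space Y"
    and f: "continuous_map X Y f" and fib: "fibre X f y = {x}"
    and u: "\<And>n. u n \<in> topspace X" and lim: "limitin Y (\<lambda>n. f (u n)) y F"
  shows "limitin X u x F"
proof -
  have "closed_map X Y f" using X Y f by (simp add: T1_Spaces.continuous_imp_closed_map)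
  have "x \<in> topspace X" and xy: "f x = y" using fib unfolding fibre_def by blast+
  moreover have "y \<in> topspace Y" using lim by (simp add: limitin_def)
  moreover have "eventually (\<lambda>n. u n \<in> U) F" if "openin X U" "x \<in> U" for U
  proof -
    have "{z \<in> topspace X. f z = y} \<subseteq> U" using fib that by (simp add: fibre_def)
    with that(1) \<open>y \<in> topspace Y\<close>
    have "\<exists>V. openin Y V \<and> y \<in> V \<and> {z \<in> topspace X. f z \<in> V} \<subseteq> U"
      using \<open>closed_map X Y f\<close> unfolding closed_map_fibre_neighbourhood by (elim conjE allE impE) auto
    then obtain V where V: "openin Y V" "y \<in> V" "{z \<in> topspace X. f z \<in> V} \<subseteq> U"
      by (elim exE conjE)
    then have "eventually (\<lambda>n. f (u n) \<in> V) F" using lim by (simp add: limitin_def)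
    then show ?thesis using V u by (auto elim!: eventually_mono)
  qed
  ultimately show ?thesis by (simp add: limitin_def)
qed

section \<open>Distal points of almost one-to-one extensions\<close>

lemma almost_one_one_extension_distal_point:
  assumes ext: "almost_one_one_extension X \<phi> Y \<psi> \<pi>" and x: "distal_point X \<phi> x"
  shows "fibre X \<pi> (\<pi> x) = {x}"
proof -
  have flow: "semiflow X \<phi>" "semiflow Y \<psi>" and min: "minimal_flow X \<phi>" "minimal_flow Y \<psi>"
    and cont: "continuous_map X Y \<pi>"
    and hom: "\<And>t x. x \<in> topspace X \<Longrightarrow> \<pi> (\<phi> t x) = \<psi> t (\<pi> x)"
    using ext unfolding almost_one_one_extension_def epimorphism_def by blast+
  obtain y0 x0 where y0: "y0 \<in> topspace Y" "fibre X \<pi> y0 = {x0}"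
    using ext unfolding almost_one_one_extension_def by blast
  have xX: "x \<in> topspace X" using x by (simp add: distal_point_def)
  then have yY: "\<pi> x \<in> topspace Y" using cont by (auto simp: continuous_map_def)
  let ?F = "filtercomap (\<lambda>t. \<psi> t (\<pi> x)) (nhdsin Y y0)"
  have F: "?F \<noteq> bot" "limitin Y (\<lambda>t. \<psi> t (\<pi> x)) y0 ?F"
    using closure_of_range_net[OF minimal_flow_closure[OF min(2) yY y0(1)]] .
  \<comment> \<open>The filter depends only on \<open>\<pi> x\<close>, so one net in
    \<open>T\<close> serves all points of the fibre, as proximality demands.\<close>
  have lim: "limitin X (\<lambda>t. \<phi> t x') x0 ?F" if "x' \<in> topspace X" "\<pi> x' = \<pi> x" for x'
  proof (rule limitin_singleton_fibre[OF _ _ cont y0(2)])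
    show "limitin Y (\<lambda>t. \<pi> (\<phi> t x')) y0 ?F" using F(2) that by (simp add: hom)
  qed (use flow that in \<open>auto simp: semiflowD\<close>)
  have "x' = x" if "x' \<in> topspace X" "\<pi> x' = \<pi> x" for x'
  proof -
    have "proximal X \<phi> x x'"
      using proximal_net[where F = ?F and t = "\<lambda>t. t", OF xX that(1) F(1)] lim xX that by blast
    moreover have "x' \<in> X closure_of orbit \<phi> x"
      using minimal_flow_closure[OF min(1) xX that(1)] by (simp add: orbit_def)
    ultimately show ?thesis using x by (simp add: distal_point_def)
  qed
  then show ?thesis using xX by (auto simp: fibre_def)
qed

section \<open>Equicontinuous invertible semiflows\<close>

text \<open>Bounding the pseudometric by \<open>e\<close> rather than naming the supremum avoids
  boundedness side conditions.\<close>

definition flow_close :: "('y \<Rightarrow> real) \<Rightarrow> ('t \<Rightarrow> 'y \<Rightarrow> 'y) \<Rightarrow> real \<Rightarrow> 'y \<Rightarrow> 'y \<Rightarrow> bool" where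
  "flow_close f \<psi> e y y' \<longleftrightarrow> (\<forall>t. \<bar>f (\<psi> t y) - f (\<psi> t y')\<bar> \<le> e)"

lemma flow_close_sym: "flow_close f \<psi> e y y' \<Longrightarrow> flow_close f \<psi> e y' y"
  by (simp add: flow_close_def abs_minus_commute)

lemma flow_close_trans:
  assumes "flow_close f \<psi> e x y" "flow_close f \<psi> d y z"
  shows "flow_close f \<psi> (e + d) x z"
  unfolding flow_close_def
proof
  fix t
  show "\<bar>f (\<psi> t x) - f (\<psi> t z)\<bar> \<le> e + d"
    using assms[unfolded flow_close_def, THEN spec, of t] by linarith
qed

lemma flow_close_act:
  assumes "semiflow Y \<psi>" "y \<in> topspace Y" "y' \<in> topspace Y" "flow_close f \<psi> e y y'"
  shows "flow_close f \<psi> e (\<psi> s y) (\<psi> s y')"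
  using assms by (simp add: flow_close_def semiflowD)

text \<open>Small neighbourhoods for the pseudometric of \<open>f\<close>: with compactness they
  make \<open>Y\<close> totally bounded for it.\<close>

lemma equicontinuous_flow_close:
  assumes Y: "semiflow Y \<psi>" and eq: "equicontinuous_flow Y \<psi>"
    and f: "continuous_map Y euclideanreal f" and e: "e > 0" and y: "y \<in> topspace Y"
  obtains U where "openin Y U" "y \<in> U" "\<And>y'. y' \<in> U \<Longrightarrow> flow_close f \<psi> e y y'"
proof -
  let ?E = "{p \<in> topspace (prod_topology Y Y). f (fst p) - f (snd p) \<in> {-e<..<e}}"
  have "openin (prod_topology Y Y) ?E"
    by (intro openin_continuous_map_preimage[where Y = euclideanreal])
      (auto intro!: continuous_map_diff continuous_map_compose[OF continuous_map_fst f, unfolded comp_def]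
         continuous_map_compose[OF continuous_map_snd f, unfolded comp_def])
  then have "entourage Y ?E" unfolding entourage_def using e by (intro conjI exI[of _ ?E]) auto
  then obtain D where D: "entourage Y D" "\<And>y'. (y, y') \<in> D \<Longrightarrow> \<forall>t. (\<psi> t y, \<psi> t y') \<in> ?E"
    using eq y unfolding equicontinuous_flow_def by meson
  then obtain O' where O': "openin (prod_topology Y Y) O'" "(y, y) \<in> O'" "O' \<subseteq> D"
    using y unfolding entourage_def by blast
  then obtain U V where "openin Y V" "y \<in> U" "y \<in> V" "U \<times> V \<subseteq> O'"
    unfolding openin_prod_topology_alt by meson
  moreover have "flow_close f \<psi> e y y'" if "y' \<in> V" for y'
    unfolding flow_close_def
  proof
    fix t
    have "(\<psi> t y, \<psi> t y') \<in> ?E" using D(2) that calculation O' by blast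
    then show "\<bar>f (\<psi> t y) - f (\<psi> t y')\<bar> \<le> e" by (simp add: abs_le_iff)
  qed
  ultimately show thesis using that by blast
qed

text \<open>A surjective nonexpansive self-map of a totally bounded pseudometric space is an isometry: along
  backward orbits of \<open>y\<close> and \<open>y'\<close> some power \<open>k \<ge> 1\<close> moves both points by at most \<open>2d\<close>.\<close>

lemma equicontinuous_flow_close_reflect:
  assumes Y: "semiflow Y \<psi>" and eq: "equicontinuous_flow Y \<psi>"
    and surj: "\<psi> s ` topspace Y = topspace Y"
    and f: "continuous_map Y euclideanreal f" and d: "d > 0"
    and y: "y \<in> topspace Y" "y' \<in> topspace Y"
    and close: "flow_close f \<psi> e (\<psi> s y) (\<psi> s y')"
  shows "flow_close f \<psi> (e + 4 * d) y y'"
proof -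
  have "\<forall>z\<in>topspace Y. \<exists>U. openin Y U \<and> z \<in> U \<and> (\<forall>z'\<in>U. flow_close f \<psi> d z z')"
    using equicontinuous_flow_close[OF Y eq f d] by metis
  from bchoice[OF this] obtain U where
    U: "\<forall>z\<in>topspace Y. openin Y (U z) \<and> z \<in> U z \<and> (\<forall>z'\<in>U z. flow_close f \<psi> d z z')" ..
  obtain D where D: "finite D" "D \<subseteq> topspace Y" "topspace Y \<subseteq> \<Union>(U ` D)"
    using compact_space_pointwise_cover[OF semiflowD(1)[OF Y], of U] U by blast
  have "\<forall>z\<in>topspace Y. \<exists>c\<in>D. flow_close f \<psi> d c z" using D U by blast
  then obtain c where c: "\<And>z. z \<in> topspace Y \<Longrightarrow> c z \<in> D \<and> flow_close f \<psi> d (c z) z" by metis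
  have act[simp]: "\<psi> s z \<in> topspace Y" if "z \<in> topspace Y" for z using Y that by (simp add: semiflowD)
  have iter: "(\<psi> s ^^ n) z \<in> topspace Y" if "z \<in> topspace Y" for n z
    using that by (induction n) auto
  have iter_close: "flow_close f \<psi> b ((\<psi> s ^^ n) z) ((\<psi> s ^^ n) z')"
    if "z \<in> topspace Y" "z' \<in> topspace Y" "flow_close f \<psi> b z z'" for n z z' b
    using that by (induction n) (auto intro!: flow_close_act[OF Y] simp: iter)
  \<comment> \<open>Forward orbits would not do, since closeness cannot yet be pulled back to
    \<open>y\<close>. Along backward orbits it is pushed forward to \<open>y\<close>.\<close>
  define g where "g = inv_into (topspace Y) (\<psi> s)"
  have g: "g z \<in> topspace Y" "\<psi> s (g z) = z" if "z \<in> topspace Y" for z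
    using that surj by (simp_all add: g_def inv_into_into f_inv_into_f)
  have gn: "(g ^^ n) z \<in> topspace Y" if "z \<in> topspace Y" for n z
    using that by (induction n) (auto simp: g)
  define a a' where "a = (\<lambda>n. (g ^^ n) y)" and "a' = (\<lambda>n. (g ^^ n) y')"
  have a: "a 0 = y" "\<And>n. a n \<in> topspace Y" "\<And>n. \<psi> s (a (Suc n)) = a n"
    and a': "a' 0 = y'" "\<And>n. a' n \<in> topspace Y" "\<And>n. \<psi> s (a' (Suc n)) = a' n"
    using y by (simp_all add: a_def a'_def gn g)
  have unwind: "(\<psi> s ^^ n) (a (n + k)) = a k" "(\<psi> s ^^ n) (a' (n + k)) = a' k" for n k
    by (induction n) (auto simp: funpow_swap1 a(3) a'(3))
  \<comment> \<open>Pigeonhole on pairs of centres, so that one pair of times \<open>n < m\<close>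
    serves both backward orbits.\<close>
  have "finite (range (\<lambda>n::nat. (c (a n), c (a' n))))"
    by (rule finite_subset[of _ "D \<times> D"]) (use c a a' D in auto)
  then have "\<not> inj (\<lambda>n::nat. (c (a n), c (a' n)))"
    using finite_imageD infinite_UNIV_nat by blast
  then obtain n m where nm: "n < m" "c (a n) = c (a m)" "c (a' n) = c (a' m)"
    unfolding inj_def by (metis Pair_inject nat_neq_iff)
  define k where "k = m - n"
  have k: "k \<ge> 1" "m = n + k" using nm by (auto simp: k_def)
  have cl: "flow_close f \<psi> (d + d) (a m) (a n)" "flow_close f \<psi> (d + d) (a' m) (a' n)"
    using flow_close_trans flow_close_sym c a(2) a'(2) nm(2,3) by metis+
  have m: "(\<psi> s ^^ m) (a n) = (\<psi> s ^^ k) y" "(\<psi> s ^^ m) (a' n) = (\<psi> s ^^ k) y'"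
    using unwind(1)[of n 0] unwind(2)[of n 0] by (simp_all add: k(2) add.commute[of n k] funpow_add a(1) a'(1))
  have 1: "flow_close f \<psi> (d + d) y ((\<psi> s ^^ k) y)" "flow_close f \<psi> (d + d) y' ((\<psi> s ^^ k) y')"
    using iter_close[OF a(2) a(2) cl(1), of m] iter_close[OF a'(2) a'(2) cl(2), of m] unwind(1)[of m 0] unwind(2)[of m 0]
    by (simp_all add: m a(1) a'(1))
  \<comment> \<open>Since \<open>k \<ge> 1\<close>, the power contains the factor
    \<open>\<psi> s\<close> to which \<open>close\<close> applies; the other \<open>k - 1\<close>
    factors are nonexpansive.\<close>
  have "flow_close f \<psi> e ((\<psi> s ^^ k) y) ((\<psi> s ^^ k) y')"
    using iter_close[OF act[OF y(1)] act[OF y(2)] close, of "k - 1"] k(1)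
    by (metis Suc_diff_1 funpow_Suc_right comp_apply less_eq_Suc_le One_nat_def)
  from flow_close_trans[OF flow_close_trans[OF 1(1) this] flow_close_sym[OF 1(2)]]
  show ?thesis by (simp add: algebra_simps)
qed

lemma equicontinuous_invertible_net:
  fixes F :: "'i filter"
  assumes Y: "semiflow Y \<psi>" and eq: "equicontinuous_flow Y \<psi>" and inv: "invertible_flow Y \<psi>"
    and F: "F \<noteq> bot" and y: "y \<in> topspace Y" and u: "\<And>n. u n \<in> topspace Y"
    and lim: "limitin Y (\<lambda>n. \<psi> (t n) y) z F" "limitin Y u y' F" and z: "\<And>n. \<psi> (t n) (u n) = z"
  shows "y = y'"
proof (rule ccontr)
  assume "y \<noteq> y'"
  have zY: "z \<in> topspace Y" "y' \<in> topspace Y" using lim by (auto simp: limitin_def)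
  obtain f :: "_ \<Rightarrow> real" where f: "continuous_map Y euclideanreal f" "f y \<noteq> f y'"
    using compact_Hausdorff_separating_function[of Y y y'] semiflowD[OF Y] y zY \<open>y \<noteq> y'\<close> by metis
  \<comment> \<open>One \<open>d\<close> for the approach to \<open>z\<close>, four lost in
    reflecting along \<open>t n\<close>, one for the approach of \<open>u n\<close> to
    \<open>y'\<close>.\<close>
  have "\<bar>f y - f y'\<bar> \<le> 6 * d" if d: "d > 0" for d
  proof -
    obtain U where U: "openin Y U" "z \<in> U" "\<And>w. w \<in> U \<Longrightarrow> flow_close f \<psi> d z w"
      using equicontinuous_flow_close[OF Y eq f(1) d zY(1)] by metis
    obtain V where V: "openin Y V" "y' \<in> V" "\<And>w. w \<in> V \<Longrightarrow> flow_close f \<psi> d y' w"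
      using equicontinuous_flow_close[OF Y eq f(1) d zY(2)] by metis
    have "eventually (\<lambda>n. \<psi> (t n) y \<in> U) F" "eventually (\<lambda>n. u n \<in> V) F"
      using lim U V by (auto simp: limitin_def)
    then have "eventually (\<lambda>n. \<psi> (t n) y \<in> U \<and> u n \<in> V) F" by (rule eventually_conj)
    then obtain n where n: "\<psi> (t n) y \<in> U" "u n \<in> V" using F eventually_happens' by blast
    have "flow_close f \<psi> d (\<psi> (t n) y) (\<psi> (t n) (u n))"
      using U(3)[OF n(1)] by (simp add: z flow_close_sym)
    then have "flow_close f \<psi> (d + 4 * d) y (u n)"
      by (intro equicontinuous_flow_close_reflect[OF Y eq _ f(1) d y u])
        (use inv in \<open>auto simp: invertible_flow_def bij_betw_def\<close>)
    then have "flow_close f \<psi> (d + 4 * d + d) y y'"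
      using V(3)[OF n(2)] flow_close_trans flow_close_sym by metis
    then have "\<bar>f (\<psi> 1 y) - f (\<psi> 1 y')\<bar> \<le> d + 4 * d + d" unfolding flow_close_def by blast
    then show ?thesis using y zY by (simp add: semiflowD[OF Y])
  qed
  from this[of "\<bar>f y - f y'\<bar> / 12"] f(2) show False by simp
qed

lemma almost_automorphic_if_extension:
  assumes ext: "almost_one_one_extension X \<phi> Y \<psi> \<pi>"
    and eq: "equicontinuous_flow Y \<psi>" and inv: "invertible_flow Y \<psi>"
  shows "almost_automorphic X \<phi>"
proof -
  have flow: "semiflow X \<phi>" "semiflow Y \<psi>" and min: "minimal_flow X \<phi>"
    and cont: "continuous_map X Y \<pi>"
    and hom: "\<And>t x. x \<in> topspace X \<Longrightarrow> \<pi> (\<phi> t x) = \<psi> t (\<pi> x)"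
    using ext unfolding almost_one_one_extension_def epimorphism_def by blast+
  obtain y0 x0 where y0: "y0 \<in> topspace Y" "fibre X \<pi> y0 = {x0}"
    using ext unfolding almost_one_one_extension_def by blast
  then have x0: "x0 \<in> topspace X" "\<pi> x0 = y0" by (auto simp: fibre_def)
  have piY: "\<pi> x \<in> topspace Y" if "x \<in> topspace X" for x
    using cont that by (auto simp: continuous_map_def)
  have "almost_automorphic_point X \<phi> x0"
    unfolding almost_automorphic_point_def
  proof (intro conjI allI impI, rule x0(1), elim conjE)
    fix F :: "('b \<times> 'a) filter" and t u y x'
    assume F: "F \<noteq> bot" and u: "\<forall>n. u n \<in> topspace X"
      and lim: "limitin X (\<lambda>n. \<phi> (t n) x0) y F" "limitin X u x' F" and y: "\<forall>n. \<phi> (t n) (u n) = y"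
    have "limitin Y (\<lambda>n. \<psi> (t n) y0) (\<pi> y) F"
      using continuous_map_limit[OF cont lim(1)] x0 by (simp add: comp_def hom)
    moreover have "limitin Y (\<lambda>n. \<pi> (u n)) (\<pi> x') F"
      using continuous_map_limit[OF cont lim(2)] by (simp add: comp_def)
    moreover have "\<psi> (t n) (\<pi> (u n)) = \<pi> y" for n using y u hom by metis
    ultimately have "y0 = \<pi> x'"
      using equicontinuous_invertible_net[OF flow(2) eq inv F y0(1), of "\<lambda>n. \<pi> (u n)"] u piY by blast
    moreover have "x' \<in> topspace X" using lim(2) by (simp add: limitin_def)
    ultimately show "x0 = x'" using y0(2) by (auto simp: fibre_def)
  qed
  moreover have "dense_orbit X \<phi> x0" using min x0 by (simp add: minimal_flow_def)
  ultimately show ?thesis unfolding almost_automorphic_def by blast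
qed

section \<open>Quotients by closed invariant equivalence relations\<close>

text \<open>The quotient lives on chosen representatives, so its points keep the type
  \<open>'x\<close>. The choice is made from the class as a set, so equivalent points share a
  representative.\<close>

lemma compact_Hausdorff_quotient:
  assumes X: "compact_space X" "Hausdorff_space X"
    and R: "equiv (topspace X) R" "closedin (prod_topology X X) R"
  obtains Y :: "'x topology" and \<pi> :: "'x \<Rightarrow> 'x" where
    "compact_space Y" "Hausdorff_space Y" "continuous_map X Y \<pi>" "\<pi> ` topspace X = topspace Y"
    "\<And>y. y \<in> topspace Y \<Longrightarrow> y \<in> topspace X \<and> \<pi> y = y"
    "\<And>x x'. x \<in> topspace X \<Longrightarrow> x' \<in> topspace X \<Longrightarrow> \<pi> x = \<pi> x' \<longleftrightarrow> (x, x') \<in> R"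
proof -
  define \<pi> where "\<pi> = (\<lambda>x. SOME z. z \<in> R `` {x})"
  have \<pi>R: "(x, \<pi> x) \<in> R" if "x \<in> topspace X" for x
  proof -
    have "x \<in> R `` {x}" using R(1) that by (rule equiv_class_self)
    then have "\<pi> x \<in> R `` {x}" unfolding \<pi>_def by (rule someI)
    then show ?thesis by simp
  qed
  have \<pi>X: "\<pi> x \<in> topspace X" if "x \<in> topspace X" for x
    using \<pi>R[OF that] R(1) by (meson equiv_class_eq_iff)
  have eq: "\<pi> x = \<pi> x' \<longleftrightarrow> (x, x') \<in> R" if "x \<in> topspace X" "x' \<in> topspace X" for x x'
  proof
    assume "(x, x') \<in> R"
    then have "R `` {x} = R `` {x'}" using R(1) by (rule equiv_class_eq[rotated])
    then show "\<pi> x = \<pi> x'" by (simp only: \<pi>_def)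
  next
    assume "\<pi> x = \<pi> x'"
    then have "(x, \<pi> x) \<in> R" "(\<pi> x, x') \<in> R"
      using \<pi>R[OF that(1)] \<pi>R[OF that(2)] R(1) by (auto simp: equiv_def dest: symD)
    then show "(x, x') \<in> R" using R(1) unfolding equiv_def by (metis transD)
  qed
  define L where "L = (\<lambda>U. U \<subseteq> \<pi> ` topspace X \<and> openin X {x \<in> topspace X. \<pi> x \<in> U})"
  have top: "istopology L"
    unfolding istopology_def
  proof (intro conjI allI impI)
    fix S T assume "L S" "L T"
    moreover have "{x \<in> topspace X. \<pi> x \<in> S \<inter> T} = {x \<in> topspace X. \<pi> x \<in> S} \<inter> {x \<in> topspace X. \<pi> x \<in> T}" by blast
    ultimately show "L (S \<inter> T)" unfolding L_def by (auto simp: openin_Int)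
  next
    fix \<K> assume K: "\<forall>K\<in>\<K>. L K"
    have "{x \<in> topspace X. \<pi> x \<in> \<Union>\<K>} = (\<Union>K\<in>\<K>. {x \<in> topspace X. \<pi> x \<in> K})" by blast
    then show "L (\<Union>\<K>)" using K unfolding L_def by (auto intro: openin_Union)
  qed
  define Y where "Y = topology L"
  have openY: "openin Y U \<longleftrightarrow> U \<subseteq> \<pi> ` topspace X \<and> openin X {x \<in> topspace X. \<pi> x \<in> U}" for U
    unfolding Y_def topology_inverse'[OF top] by (simp add: L_def)
  have topY: "topspace Y = \<pi> ` topspace X"
  proof (rule subset_antisym)
    show "topspace Y \<subseteq> \<pi> ` topspace X" using openY openin_topspace by blast
    have "{x \<in> topspace X. \<pi> x \<in> \<pi> ` topspace X} = topspace X" by blast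
    then have "openin Y (\<pi> ` topspace X)" unfolding openY by simp
    then show "\<pi> ` topspace X \<subseteq> topspace Y" by (rule openin_subset)
  qed
  have q: "quotient_map X Y \<pi>" unfolding quotient_map_def using topY openY by auto
  then have cont: "continuous_map X Y \<pi>" by (rule quotient_imp_continuous_map)
  have "closed_map X Y \<pi>"
    unfolding closed_map_def
  proof (intro allI impI)
    fix C assume C: "closedin X C"
    have CX: "C \<subseteq> topspace X" using C by (rule closedin_subset)
    have RX: "(x, c) \<in> R \<Longrightarrow> x \<in> topspace X" for x c using R(1) by (meson equiv_class_eq_iff)
    \<comment> \<open>The saturation of \<open>C\<close> is a projection along a compact factor,
      hence closed; closedness of the map then carries normality and the Hausdorff property to
      \<open>Y\<close>.\<close>
    have "{x \<in> topspace X. \<pi> x \<in> \<pi> ` C} = fst ` (R \<inter> (topspace X \<times> C))" (is "?L = ?R")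
    proof (rule subset_antisym; rule subsetI)
      fix x assume "x \<in> ?L"
      then obtain c where c: "x \<in> topspace X" "c \<in> C" "\<pi> x = \<pi> c" by blast
      then have "(x, c) \<in> R" using eq CX by blast
      then have "(x, c) \<in> R \<inter> (topspace X \<times> C)" using c by blast
      then show "x \<in> ?R" by force
    next
      fix x assume "x \<in> ?R"
      then obtain c where c: "(x, c) \<in> R" "x \<in> topspace X" "c \<in> C" by auto
      then have "\<pi> x = \<pi> c" using eq CX by blast
      then show "x \<in> ?L" using c by blast
    qed
    moreover have "closedin X (fst ` (R \<inter> (topspace X \<times> C)))"
      using closed_map_fst[OF X(1), of X] R(2) C
      by (simp add: closed_map_def closedin_Int closedin_prod_Times_iff)
    moreover have "\<pi> ` C \<subseteq> topspace Y" using CX topY by blast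
    ultimately show "closedin Y (\<pi> ` C)" using q unfolding quotient_map_closedin by metis
  qed
  then have Y2: "Hausdorff_space Y"
    using normal_Hausdorff_space_closed_continuous_map_image[of X Y \<pi>] X cont topY
    by (simp add: compact_Hausdorff_or_regular_imp_normal_space)
  have Y1: "compact_space Y"
    using image_compactin[OF X(1)[unfolded compact_space_def] cont] topY by (simp add: compact_space_def)
  have rep: "y \<in> topspace X \<and> \<pi> y = y" if y: "y \<in> topspace Y" for y
  proof -
    obtain x where x: "x \<in> topspace X" "y = \<pi> x" using y topY by blast
    have "(\<pi> x, x) \<in> R" using \<pi>R[OF x(1)] R(1) by (auto simp: equiv_def dest: symD)
    then show ?thesis using eq \<pi>X x by blast
  qed
  show thesis by (rule that[OF Y1 Y2 cont topY[symmetric] rep eq])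
qed

text \<open>The difficulty is joint continuity, because the product of a quotient map with the
  identity of an arbitrary \<open>T\<close> need not be a quotient map. Here \<open>\<pi>\<close> is
  proper, so the product is closed and therefore a quotient map.\<close>

lemma semiflow_quotient:
  fixes X :: "'x topology" and \<phi> :: "'t::topological_monoid_mult \<Rightarrow> 'x \<Rightarrow> 'x"
  assumes flow: "semiflow X \<phi>"
    and R: "equiv (topspace X) R" "closedin (prod_topology X X) R"
    and inv: "\<And>t x x'. (x, x') \<in> R \<Longrightarrow> (\<phi> t x, \<phi> t x') \<in> R"
  obtains Y :: "'x topology" and \<psi> \<pi> where
    "semiflow Y \<psi>" "epimorphism X \<phi> Y \<psi> \<pi>"
    "\<And>x x'. x \<in> topspace X \<Longrightarrow> x' \<in> topspace X \<Longrightarrow> \<pi> x = \<pi> x' \<longleftrightarrow> (x, x') \<in> R"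
proof -
  note X = semiflowD[OF flow]
  obtain Y :: "'x topology" and \<pi> where Y: "compact_space Y" "Hausdorff_space Y"
    and cont: "continuous_map X Y \<pi>" and surj: "\<pi> ` topspace X = topspace Y"
    and rep: "\<And>y. y \<in> topspace Y \<Longrightarrow> y \<in> topspace X \<and> \<pi> y = y"
    and eq: "\<And>x x'. x \<in> topspace X \<Longrightarrow> x' \<in> topspace X \<Longrightarrow> \<pi> x = \<pi> x' \<longleftrightarrow> (x, x') \<in> R"
    using compact_Hausdorff_quotient[OF X(1,2) R] by blast
  define \<psi> where "\<psi> = (\<lambda>t y. \<pi> (\<phi> t y))"
  have piY: "\<pi> x \<in> topspace Y" if "x \<in> topspace X" for x using that surj by blast
  have hom: "\<pi> (\<phi> t x) = \<psi> t (\<pi> x)" if x: "x \<in> topspace X" for t x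
  proof -
    have "(x, \<pi> x) \<in> R" using eq[of x "\<pi> x"] rep[OF piY[OF x]] x by simp
    then show ?thesis using inv eq X(4) x rep[OF piY[OF x]] by (simp add: \<psi>_def)
  qed
  let ?q = "\<lambda>(t::'t, x). (t, \<pi> x)"
  have "proper_map (euclidean :: 't topology) euclidean (\<lambda>t. t)"
    using proper_map_id[of "euclidean :: 't topology"] by (simp only: id_def)
  then have "proper_map (prod_topology euclidean X) (prod_topology euclidean Y) ?q"
    unfolding proper_map_prod
    using continuous_imp_proper_map[OF X(1) Hausdorff_imp_kc_space[OF Y(2)] cont] by simp
  then have "closed_map (prod_topology euclidean X) (prod_topology euclidean Y) ?q"
    by (rule proper_imp_closed_map)
  moreover have "continuous_map (prod_topology euclidean X) (prod_topology euclidean Y) ?q"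
    using cont by (simp add: continuous_map_prod_top)
  moreover have "?q ` topspace (prod_topology euclidean X) = topspace (prod_topology euclidean Y)"
    unfolding topspace_prod_topology surj[symmetric] by force
  ultimately have q: "quotient_map (prod_topology euclidean X) (prod_topology euclidean Y) ?q"
    by (simp add: continuous_closed_imp_quotient_map)
  have "continuous_map (prod_topology euclidean X) Y (\<pi> \<circ> (\<lambda>(t, x). \<phi> t x))"
    using flow cont unfolding semiflow_def by (blast intro: continuous_map_compose)
  then have "continuous_map (prod_topology euclidean X) Y ((\<lambda>(t, y). \<psi> t y) \<circ> ?q)"
    by (rule continuous_map_eq) (auto simp: hom)
  then have joint: "continuous_map (prod_topology euclidean Y) Y (\<lambda>(t, y). \<psi> t y)"
    by (rule continuous_compose_quotient_map[OF q])
  have "semiflow Y \<psi>"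
    unfolding semiflow_def
  proof (intro conjI ballI allI Y joint)
    show "topspace Y \<noteq> {}" using surj flow unfolding semiflow_def by blast
    fix y assume y: "y \<in> topspace Y"
    show "\<psi> 1 y = y" using X(5) rep[OF y] by (simp add: \<psi>_def)
    fix s t
    have "\<psi> s y = \<pi> (\<phi> s y)" by (simp add: \<psi>_def)
    then have "\<psi> t (\<psi> s y) = \<pi> (\<phi> t (\<phi> s y))"
      using hom[of "\<phi> s y" t] X(4) rep[OF y] by simp
    also have "\<dots> = \<psi> (t * s) y" using X(6) rep[OF y] by (simp add: \<psi>_def)
    finally show "\<psi> t (\<psi> s y) = \<psi> (t * s) y" .
  qed
  moreover have "epimorphism X \<phi> Y \<psi> \<pi>" unfolding epimorphism_def using cont surj hom by blast
  ultimately show thesis using that eq by blast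
qed

lemma minimal_flow_epimorphism:
  assumes min: "minimal_flow X \<phi>" and epi: "epimorphism X \<phi> Y \<psi> \<pi>"
  shows "minimal_flow Y \<psi>"
  unfolding minimal_flow_def dense_orbit_def orbit_def
proof (intro ballI subset_antisym closure_of_subset_topspace subsetI)
  fix y y' assume "y \<in> topspace Y" "y' \<in> topspace Y"
  then have "y \<in> \<pi> ` topspace X" "y' \<in> \<pi> ` topspace X"
    using epi by (simp_all add: epimorphism_def)
  then obtain x x' where x: "x \<in> topspace X" "\<pi> x = y" and x': "x' \<in> topspace X" "\<pi> x' = y'"
    by blast
  have "\<pi> ` (X closure_of range (\<lambda>t. \<phi> t x)) \<subseteq> Y closure_of (\<pi> ` range (\<lambda>t. \<phi> t x))"
    using epi by (simp add: epimorphism_def continuous_map_image_closure_subset)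
  moreover have "\<pi> ` range (\<lambda>t. \<phi> t x) = range (\<lambda>t. \<psi> t y)"
    using epi x unfolding epimorphism_def image_image by simp
  ultimately show "y' \<in> Y closure_of range (\<lambda>t. \<psi> t y)"
    using minimal_flow_closure[OF min x(1) x'(1)] x'(2) by auto
qed

text \<open>The base \<open>E\<close> plays the role of an invariant uniformity coarser than that of \<open>X\<close>; the factor is its
  separated quotient.\<close>

lemma equicontinuous_quotient:
  fixes X :: "'x topology" and \<phi> :: "'t::topological_monoid_mult \<Rightarrow> 'x \<Rightarrow> 'x"
    and \<E> :: "('x \<times> 'x) set set"
  assumes flow: "semiflow X \<phi>" and min: "minimal_flow X \<phi>"
    and surjX: "\<And>t. \<phi> t ` topspace X = topspace X"
    and ne: "\<E> \<noteq> {}" and opn: "\<And>E. E \<in> \<E> \<Longrightarrow> openin (prod_topology X X) E"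
    and refl: "\<And>E x. E \<in> \<E> \<Longrightarrow> x \<in> topspace X \<Longrightarrow> (x, x) \<in> E"
    and sym: "\<And>E. E \<in> \<E> \<Longrightarrow> sym E"
    and dir: "\<And>E E'. E \<in> \<E> \<Longrightarrow> E' \<in> \<E> \<Longrightarrow> \<exists>E''\<in>\<E>. E'' \<subseteq> E \<inter> E'"
    and comp: "\<And>E. E \<in> \<E> \<Longrightarrow> \<exists>E'\<in>\<E>. E' O E' \<subseteq> E"
    and inv: "\<And>E x x' t. E \<in> \<E> \<Longrightarrow> x \<in> topspace X \<Longrightarrow> x' \<in> topspace X \<Longrightarrow>
        (\<phi> t x, \<phi> t x') \<in> E \<longleftrightarrow> (x, x') \<in> E"
  obtains Y :: "'x topology" and \<psi> \<pi> where
    "semiflow Y \<psi>" "minimal_flow Y \<psi>" "epimorphism X \<phi> Y \<psi> \<pi>"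
    "equicontinuous_flow Y \<psi>" "invertible_flow Y \<psi>"
    "\<And>x x'. x \<in> topspace X \<Longrightarrow> x' \<in> topspace X \<Longrightarrow> \<pi> x = \<pi> x' \<longleftrightarrow> (x, x') \<in> \<Inter>\<E>"
proof -
  note X = semiflowD[OF flow]
  let ?R = "\<Inter>\<E>" and ?X2 = "prod_topology X X"
  have sub: "E \<subseteq> topspace X \<times> topspace X" if "E \<in> \<E>" for E
    using openin_subset[OF opn[OF that]] by simp
  \<comment> \<open>The closure of \<open>E2\<close> lies in the threefold composite of
    \<open>E2\<close>; two halvings make room for it. This exhibits the relation to be divided out
    as an intersection of closed sets.\<close>
  have closure: "\<exists>E'\<in>\<E>. ?X2 closure_of E' \<subseteq> E" if E: "E \<in> \<E>" for E
  proof -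
    obtain E1 where E1: "E1 \<in> \<E>" "E1 O E1 \<subseteq> E" using comp E by blast
    obtain E2 where E2: "E2 \<in> \<E>" "E2 O E2 \<subseteq> E1" using comp E1 by blast
    have "(x, x') \<in> E" if "(x, x') \<in> ?X2 closure_of E2" for x x'
    proof -
      have xX: "x \<in> topspace X" "x' \<in> topspace X"
        using that closure_of_subset_topspace[of ?X2 E2] by auto
      have rect: "\<exists>U. openin X U \<and> z \<in> U \<and> U \<times> U \<subseteq> E2" if z: "z \<in> topspace X" for z
      proof -
        obtain U V where "openin X U" "openin X V" "z \<in> U" "z \<in> V" "U \<times> V \<subseteq> E2"
          using opn[OF E2(1)] refl[OF E2(1) z] unfolding openin_prod_topology_alt by meson
        then show ?thesis by (intro exI[of _ "U \<inter> V"]) auto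
      qed
      obtain U U' where U: "openin X U" "x \<in> U" "U \<times> U \<subseteq> E2" and U': "openin X U'" "x' \<in> U'" "U' \<times> U' \<subseteq> E2"
        using rect xX by meson
      have "openin ?X2 (U \<times> U')" using U U' by (simp add: openin_prod_Times_iff)
      moreover have "(x, x') \<in> U \<times> U'" using U U' by simp
      ultimately have "\<exists>q. q \<in> E2 \<and> q \<in> U \<times> U'"
        using that[unfolded in_closure_of, THEN conjunct2, rule_format, of "U \<times> U'"] by simp
      then obtain z z' where z: "z \<in> U" "z' \<in> U'" "(z, z') \<in> E2" by auto
      then have "(x, z) \<in> E2" "(z, z') \<in> E2" "(z', x') \<in> E2" using U U' by blast+
      then have "(x, z') \<in> E1" "(z', x') \<in> E1"
        using E2(2) refl[OF E2(1) xX(2)] sub[OF E2(1)] by blast+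
      then show ?thesis using E1(2) by blast
    qed
    then show ?thesis using E2(1) by (intro bexI[of _ E2]) auto
  qed
  have R_closure: "?R = (\<Inter>E\<in>\<E>. ?X2 closure_of E)"
  proof
    show "(\<Inter>E\<in>\<E>. ?X2 closure_of E) \<subseteq> ?R" using closure by blast
    show "?R \<subseteq> (\<Inter>E\<in>\<E>. ?X2 closure_of E)"
      using closure_of_subset[of _ ?X2] sub by (simp add: le_INF_iff) (metis (no_types, lifting) Inter_lower order_trans)
  qed
  have Rclosed: "closedin ?X2 ?R"
    unfolding R_closure using ne by (intro closedin_Inter) auto
  have Requiv: "equiv (topspace X) ?R"
  proof (rule equivI)
    show "?R \<subseteq> topspace X \<times> topspace X" using sub ne by blast
    show "refl_on (topspace X) ?R" using refl by (simp add: refl_on_def)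
    show "sym ?R" using sym unfolding sym_def by blast
    show "trans ?R"
    proof (intro transI InterI)
      fix x y z E assume "(x, y) \<in> ?R" "(y, z) \<in> ?R" "E \<in> \<E>"
      then show "(x, z) \<in> E" using comp by blast
    qed
  qed
  have Rinv: "(\<phi> t x, \<phi> t x') \<in> ?R \<longleftrightarrow> (x, x') \<in> ?R" if "x \<in> topspace X" "x' \<in> topspace X" for t x x'
    using inv that by simp
  have Rinv': "(\<phi> t x, \<phi> t x') \<in> ?R" if "(x, x') \<in> ?R" for t x x'
  proof -
    have "x \<in> topspace X" "x' \<in> topspace X" using that sub ne by blast+
    with that Rinv show ?thesis by blast
  qed
  obtain Y :: "'x topology" and \<psi> \<pi> where Y: "semiflow Y \<psi>" and epi: "epimorphism X \<phi> Y \<psi> \<pi>"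
    and eq: "\<And>x x'. x \<in> topspace X \<Longrightarrow> x' \<in> topspace X \<Longrightarrow> \<pi> x = \<pi> x' \<longleftrightarrow> (x, x') \<in> ?R"
    using semiflow_quotient[OF flow Requiv Rclosed Rinv'] by blast
  have cont: "continuous_map X Y \<pi>" and surj: "\<pi> ` topspace X = topspace Y"
    and hom: "\<And>t x. x \<in> topspace X \<Longrightarrow> \<pi> (\<phi> t x) = \<psi> t (\<pi> x)"
    using epi unfolding epimorphism_def by blast+
  let ?Y2 = "prod_topology Y Y" and ?p = "\<lambda>(x, x'). (\<pi> x, \<pi> x')"
  have pcont: "continuous_map ?X2 ?Y2 ?p" using cont by (simp add: continuous_map_prod_top)
  have X2: "compact_space ?X2" using X(1) by (simp add: compact_space_prod_topology)
  have "Hausdorff_space ?Y2" using semiflowD(2)[OF Y] by (simp add: Hausdorff_space_prod_topology)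
  then have pclosed: "closed_map ?X2 ?Y2 ?p"
    using pcont X2 by (simp add: T1_Spaces.continuous_imp_closed_map)
  have entourage: "entourage Y (?p ` E)" if E: "E \<in> \<E>" for E
    unfolding entourage_def
  proof (intro conjI exI ballI)
    show "?p ` E \<subseteq> topspace Y \<times> topspace Y" using sub[OF E] surj by auto
    \<comment> \<open>\<open>\<pi>\<close> need not be open, so the open set is the complement of a
      closed image. It contains the diagonal because pairs identified by \<open>\<pi>\<close> lie in
      \<open>E\<close>.\<close>
    let ?K = "topspace ?X2 - E"
    have "closedin ?X2 ?K" using opn[OF E] by blast
    then have "closedin ?Y2 (?p ` ?K)" using pclosed unfolding closed_map_def by blast
    then show "openin ?Y2 (topspace ?Y2 - ?p ` ?K)" by (rule openin_diff[OF openin_topspace])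
    show "(y, y) \<in> topspace ?Y2 - ?p ` ?K" if "y \<in> topspace Y" for y
      using that eq E by auto
    show "topspace ?Y2 - ?p ` ?K \<subseteq> ?p ` E"
    proof
      fix q assume q: "q \<in> topspace ?Y2 - ?p ` ?K"
      then have "q \<in> (\<pi> ` topspace X) \<times> (\<pi> ` topspace X)" using surj by simp
      then obtain x x' where x: "x \<in> topspace X" "x' \<in> topspace X" "q = ?p (x, x')" by auto
      have "(x, x') \<in> E"
      proof (rule ccontr)
        assume "(x, x') \<notin> E"
        then have "(x, x') \<in> ?K" using x by simp
        then have "q \<in> ?p ` ?K" unfolding x(3) by (rule imageI)
        with q show False by (simp only: Diff_iff simp_thms)
      qed
      then show "q \<in> ?p ` E" unfolding x(3) by (rule imageI)
    qed
  qed
  \<comment> \<open>Compactness: the pairs mapped outside \<open>U\<close> are covered by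
    complements of closures of members of the base. Finitely many suffice, and directedness replaces
    them by one \<open>E\<close>.\<close>
  have small: "\<exists>E\<in>\<E>. ?p ` E \<subseteq> U" if U: "openin ?Y2 U" "\<forall>y\<in>topspace Y. (y, y) \<in> U" for U
  proof -
    define K where "K = topspace ?X2 - {q \<in> topspace ?X2. ?p q \<in> U}"
    have "openin ?X2 {q \<in> topspace ?X2. ?p q \<in> U}"
      using openin_continuous_map_preimage[OF pcont U(1)] .
    then have "closedin ?X2 K" unfolding K_def by blast
    then have K: "compactin ?X2 K" using X2 by (simp add: closedin_compact_space)
    have "K \<inter> ?R = {}"
    proof (rule equals0I)
      fix q assume q: "q \<in> K \<inter> ?R"
      obtain x x' where x: "q = (x, x')" by fastforce
      then have xX: "x \<in> topspace X" "x' \<in> topspace X" using q by (auto simp: K_def)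
      have "\<pi> x = \<pi> x'" using eq[OF xX] q x by blast
      moreover have "\<pi> x' \<in> topspace Y" using xX surj by blast
      ultimately have "?p q \<in> U" using U(2) x by simp
      with q show False by (simp add: K_def)
    qed
    have "K \<subseteq> (\<Union>E\<in>\<E>. topspace ?X2 - ?X2 closure_of E)"
    proof
      fix q assume q: "q \<in> K"
      then have "q \<notin> ?R" using \<open>K \<inter> ?R = {}\<close> by blast
      then obtain E where "E \<in> \<E>" "q \<notin> ?X2 closure_of E" unfolding R_closure by blast
      moreover have "q \<in> topspace ?X2" using q unfolding K_def by (rule DiffD1)
      ultimately show "q \<in> (\<Union>E\<in>\<E>. topspace ?X2 - ?X2 closure_of E)" by blast
    qed
    moreover have "openin ?X2 V" if "V \<in> (\<lambda>E. topspace ?X2 - ?X2 closure_of E) ` \<E>" for V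
      using that openin_diff[OF openin_topspace closedin_closure_of] by blast
    ultimately have "\<exists>\<F>. finite \<F> \<and> \<F> \<subseteq> (\<lambda>E. topspace ?X2 - ?X2 closure_of E) ` \<E> \<and> K \<subseteq> \<Union>\<F>"
      by (rule compactinD[OF K, rotated])
    then obtain \<F> where \<F>: "finite \<F>" "\<F> \<subseteq> (\<lambda>E. topspace ?X2 - ?X2 closure_of E) ` \<E>" "K \<subseteq> \<Union>\<F>"
      by (elim exE conjE)
    obtain D where D: "D \<subseteq> \<E>" "finite D" "\<F> = (\<lambda>E. topspace ?X2 - ?X2 closure_of E) ` D"
      using finite_subset_image[OF \<F>(1,2)] by (elim exE conjE)
    from D(2,1) have "\<exists>E\<in>\<E>. \<forall>E'\<in>D. E \<subseteq> E'"
    proof (induction D)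
      case empty
      then show ?case using ne by blast
    next
      case (insert E' D)
      then obtain E where E: "E \<in> \<E>" "\<forall>E'\<in>D. E \<subseteq> E'" by blast
      obtain E'' where "E'' \<in> \<E>" "E'' \<subseteq> E \<inter> E'" using dir[OF E(1)] insert.prems by blast
      with E show ?case by (intro bexI[of _ E'']) auto
    qed
    then obtain E where E: "E \<in> \<E>" "\<And>E'. E' \<in> D \<Longrightarrow> E \<subseteq> E'" by blast
    have notK: "q \<notin> K" if "q \<in> E" for q
    proof
      assume "q \<in> K"
      then have "q \<in> \<Union>\<F>" using \<F>(3) by (rule subsetD[rotated])
      then obtain E' where E': "E' \<in> D" "q \<notin> ?X2 closure_of E'" unfolding D(3) by auto
      have "E' \<in> \<E>" using D(1) E'(1) by (rule subsetD)
      then have "E' \<subseteq> ?X2 closure_of E'" using sub by (simp add: closure_of_subset)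
      moreover have "q \<in> E'" using E(2)[OF E'(1)] that by (rule subsetD)
      ultimately show False using E'(2) by (auto dest: subsetD)
    qed
    have "?p ` E \<subseteq> U"
    proof (rule image_subsetI)
      fix q assume q: "q \<in> E"
      then have "q \<in> topspace ?X2" using sub[OF E(1)] by auto
      moreover have "q \<notin> K" using notK[OF q] .
      ultimately show "?p q \<in> U" unfolding K_def by simp
    qed
    with E(1) show ?thesis ..
  qed
  have "equicontinuous_flow Y \<psi>"
    unfolding equicontinuous_flow_def
  proof (intro ballI allI impI)
    fix y F assume y: "y \<in> topspace Y" and F: "entourage Y F"
    then obtain U where U: "openin ?Y2 U" "\<forall>y\<in>topspace Y. (y, y) \<in> U" "U \<subseteq> F"
      unfolding entourage_def by blast
    obtain E where E: "E \<in> \<E>" "?p ` E \<subseteq> U" using small[OF U(1,2)] by blast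
    have "(\<psi> t y, \<psi> t y') \<in> F" if yy: "(y, y') \<in> ?p ` E" for y' t
    proof -
      obtain x x' where x: "(x, x') \<in> E" "y = \<pi> x" "y' = \<pi> x'" using yy by auto
      then have xX: "x \<in> topspace X" "x' \<in> topspace X" using sub[OF E(1)] by auto
      then have "(\<phi> t x, \<phi> t x') \<in> E" using inv E(1) x(1) by blast
      then have "?p (\<phi> t x, \<phi> t x') \<in> U" using E(2) by (rule subsetD[OF _ imageI, rotated])
      then have "?p (\<phi> t x, \<phi> t x') \<in> F" using U(3) by (rule subsetD[rotated])
      then show ?thesis using xX x by (simp add: hom)
    qed
    then show "\<exists>D. entourage Y D \<and> (\<forall>x'. (y, x') \<in> D \<longrightarrow> (\<forall>t. (\<psi> t y, \<psi> t x') \<in> F))"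
      using entourage[OF E(1)] by blast
  qed
  moreover have "invertible_flow Y \<psi>"
    unfolding invertible_flow_def bij_betw_def
  proof (intro allI conjI)
    fix t
    \<comment> \<open>Invariance of the base is an equivalence; its reflecting half gives
      injectivity.\<close>
    show "inj_on (\<psi> t) (topspace Y)"
    proof (rule inj_onI)
      fix y y' assume yY: "y \<in> topspace Y" "y' \<in> topspace Y" and same: "\<psi> t y = \<psi> t y'"
      obtain x x' where x: "x \<in> topspace X" "x' \<in> topspace X" "y = \<pi> x" "y' = \<pi> x'"
        using yY unfolding surj[symmetric] by blast
      with same have "\<pi> (\<phi> t x) = \<pi> (\<phi> t x')" by (simp add: hom)
      then show "y = y'" using eq X(4) Rinv x by simp
    qed
    have "\<psi> t ` topspace Y = \<pi> ` \<phi> t ` topspace X"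
      unfolding surj[symmetric] image_image by (simp add: hom)
    then show "\<psi> t ` topspace Y = topspace Y" using surjX surj by simp
  qed
  ultimately show thesis
    using that[OF Y minimal_flow_epimorphism[OF min epi] epi] eq by blast
qed

section \<open>The equicontinuous factor at an almost automorphic point\<close>

locale almost_automorphic_semiflow =
  fixes X :: "'x topology" and \<phi> :: "'t::topological_monoid_mult \<Rightarrow> 'x \<Rightarrow> 'x" and x0 :: 'x
  assumes flow: "semiflow X \<phi>" and min: "minimal_flow X \<phi>"
    and comm: "\<And>s t :: 't. s * t = t * s"
    and fibres: "\<And>t. fibre_continuous X (\<phi> t)"
    and aa: "almost_automorphic_point X \<phi> x0"
begin

lemmas compact = semiflowD(1)[OF flow]
  and Hausdorff = semiflowD(2)[OF flow]
  and cont = semiflowD(3)[OF flow]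
  and act_closed [simp] = semiflowD(4)[OF flow]
  and act_mult = semiflowD(6)[OF flow]

lemma base [simp]: "x0 \<in> topspace X"
  using aa by (simp add: almost_automorphic_point_def)

section \<open>Transitions as homeomorphisms\<close>

lemma act_commute: "x \<in> topspace X \<Longrightarrow> \<phi> s (\<phi> t x) = \<phi> t (\<phi> s x)"
  by (simp add: act_mult comm)

lemma closed_act: "closedin X C \<Longrightarrow> closedin X (\<phi> t ` C)"
  using T1_Spaces.continuous_imp_closed_map[OF cont compact Hausdorff] by (simp add: closed_map_def)

text \<open>By commutativity the orbit of \<open>\<phi> t x0\<close> lies in the closed image of
  \<open>\<phi> t\<close>, and by minimality it is dense.\<close>

lemma surj: "\<phi> t ` topspace X = topspace X"
proof
  show "\<phi> t ` topspace X \<subseteq> topspace X" by auto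
  have "range (\<lambda>s. \<phi> s (\<phi> t x0)) \<subseteq> \<phi> t ` topspace X"
    by (auto simp: act_commute[of x0 _ t])
  then have "X closure_of range (\<lambda>s. \<phi> s (\<phi> t x0)) \<subseteq> \<phi> t ` topspace X"
    by (rule closure_of_minimal) (simp add: closed_act)
  then show "topspace X \<subseteq> \<phi> t ` topspace X"
    using minimal_flow_closure[OF min act_closed[OF base]] by blast
qed

lemma preimage:
  assumes "x \<in> topspace X"
  obtains z where "z \<in> topspace X" "\<phi> t z = x"
proof -
  have "x \<in> \<phi> t ` topspace X" using assms by (simp only: surj)
  then show thesis using that by (auto elim!: imageE)
qed

text \<open>Almost automorphy for constant nets.\<close>

lemma inj_at_base:
  assumes z: "z \<in> topspace X" and eq: "\<phi> t z = \<phi> t x0"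
  shows "z = x0"
  using almost_automorphic_point_net[OF aa, of "top :: unit filter" "\<lambda>_. z" "\<lambda>_. t" "\<phi> t x0" z] z eq
  by (simp add: limitin_const trivial_limit_def)

lemma inj_at_orbit:
  assumes z: "z \<in> topspace X" and eq: "\<phi> t z = \<phi> t (\<phi> s x0)"
  shows "z = \<phi> s x0"
proof -
  obtain w where w: "w \<in> topspace X" "\<phi> s w = z" using preimage[OF z] .
  then have "\<phi> (t * s) w = \<phi> (t * s) x0" using eq by (simp add: act_mult flip: w(2))
  then show ?thesis using inj_at_base w by blast
qed

text \<open>The fibre over \<open>\<phi> t x\<close> is a limit of the singleton fibres over points of the orbit of \<open>x0\<close>.\<close>

lemma inj_act:
  assumes x: "x \<in> topspace X" "x' \<in> topspace X" and eq: "\<phi> t x = \<phi> t x'"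
  shows "x = x'"
proof (rule ccontr)
  assume "x \<noteq> x'"
  then obtain U V where U: "openin X U" "openin X V" "x \<in> U" "x' \<in> V" "disjnt U V"
    using Hausdorff x unfolding Hausdorff_space_def by meson
  let ?F = "filtercomap (\<lambda>s. \<phi> s x0) (nhdsin X x)"
  have F: "?F \<noteq> bot" "limitin X (\<lambda>s. \<phi> s x0) x ?F"
    using closure_of_range_net[OF minimal_flow_closure[OF min base x(1)]] .
  have "limitin X (\<lambda>s. \<phi> t (\<phi> s x0)) (\<phi> t x) ?F"
    using continuous_map_limit[OF cont F(2)] by (simp add: comp_def)
  then have lim: "hausdorff_limit X (\<lambda>s. fibre X (\<phi> t) (\<phi> t (\<phi> s x0))) (fibre X (\<phi> t) (\<phi> t x)) ?F"
    by (intro fibre_continuous_net[OF fibres F(1)]) simp_all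
  have fib: "fibre X (\<phi> t) (\<phi> t (\<phi> s x0)) = {\<phi> s x0}" for s
    using inj_at_orbit unfolding fibre_def by auto
  \<comment> \<open>This entourage restricts only pairs ending in \<open>x'\<close>: their first
    entry must lie in \<open>V\<close>. As \<open>x'\<close> lies in the limit fibre, it forces
    \<open>\<phi> s x0\<close> into \<open>V\<close>, although \<open>s\<close> is chosen with
    \<open>\<phi> s x0\<close> in \<open>U\<close>.\<close>
  let ?E = "topspace (prod_topology X X) - (topspace X - V) \<times> {x'}"
  have "closedin (prod_topology X X) ((topspace X - V) \<times> {x'})"
    using U x closedin_Hausdorff_singleton[OF Hausdorff] by (simp add: closedin_prod_Times_iff closedin_diff)
  then have "openin (prod_topology X X) ?E" by (rule openin_diff[OF openin_topspace])
  then have "entourage X ?E" unfolding entourage_def using U by (intro conjI exI[of _ ?E]) auto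
  with lim have "eventually (\<lambda>s. {\<phi> s x0} \<subseteq> ?E `` fibre X (\<phi> t) (\<phi> t x) \<and>
      fibre X (\<phi> t) (\<phi> t x) \<subseteq> ?E `` {\<phi> s x0}) ?F"
    unfolding hausdorff_limit_def fib by (elim allE impE)
  then have "eventually (\<lambda>s. fibre X (\<phi> t) (\<phi> t x) \<subseteq> ?E `` {\<phi> s x0}) ?F"
    by (rule eventually_mono) (rule conjunct2)
  moreover have "eventually (\<lambda>s. \<phi> s x0 \<in> U) ?F"
    using F(2) U by (simp add: limitin_def)
  ultimately have "eventually (\<lambda>s. fibre X (\<phi> t) (\<phi> t x) \<subseteq> ?E `` {\<phi> s x0} \<and> \<phi> s x0 \<in> U) ?F"
    by (rule eventually_conj)
  then obtain s where s: "fibre X (\<phi> t) (\<phi> t x) \<subseteq> ?E `` {\<phi> s x0}" "\<phi> s x0 \<in> U"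
    using eventually_happens'[OF F(1)] by blast
  have "x' \<in> fibre X (\<phi> t) (\<phi> t x)" using x eq by (simp add: fibre_def)
  then have "x' \<in> ?E `` {\<phi> s x0}" using s(1) by (rule subsetD[rotated])
  then have "(\<phi> s x0, x') \<in> ?E" by (simp only: Image_singleton_iff)
  then have "\<phi> s x0 \<in> V" by simp
  with s(2) U(5) show False by (simp add: disjnt_iff)
qed

lemma act_image_iff:
  assumes "W \<subseteq> topspace X" "x \<in> topspace X"
  shows "\<phi> t x \<in> \<phi> t ` W \<longleftrightarrow> x \<in> W"
  using assms inj_act by blast

lemma open_act:
  assumes W: "openin X W"
  shows "openin X (\<phi> t ` W)"
proof -
  have WX: "W \<subseteq> topspace X" using W by (rule openin_subset)
  have "\<phi> t ` W = topspace X - \<phi> t ` (topspace X - W)"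
  proof (rule subset_antisym; rule subsetI)
    fix y assume y: "y \<in> \<phi> t ` W"
    then obtain w where w: "w \<in> W" "y = \<phi> t w" by blast
    then have wX: "w \<in> topspace X" using WX by blast
    have "y \<notin> \<phi> t ` (topspace X - W)"
      unfolding w(2) using w(1) wX by (simp add: act_image_iff)
    then show "y \<in> topspace X - \<phi> t ` (topspace X - W)" using w wX by simp
  next
    fix y assume y: "y \<in> topspace X - \<phi> t ` (topspace X - W)"
    then obtain w where "w \<in> topspace X" "\<phi> t w = y" by (blast elim: preimage)
    with y show "y \<in> \<phi> t ` W" by blast
  qed
  moreover have "closedin X (\<phi> t ` (topspace X - W))" using W by (intro closed_act) blast
  ultimately show ?thesis by (simp add: openin_diff)
qed

text \<open>The preimage of \<open>W\<close> under the fraction \<open>t^-1 s\<close>.\<close>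

lemma open_vimage:
  assumes "openin X W"
  shows "openin X {x \<in> topspace X. \<phi> s x \<in> \<phi> t ` W}"
  using openin_continuous_map_preimage[OF cont open_act[OF assms]] .

section \<open>Recurrence at the almost automorphic point\<close>

lemma shrink:
  assumes "openin X W" "x \<in> W"
  obtains V where "openin X V" "x \<in> V" "X closure_of V \<subseteq> W"
proof -
  have "neighbourhood_base_of (closedin X) X"
    using compact_Hausdorff_imp_regular_space compact Hausdorff
    by (simp add: neighbourhood_base_of_closedin)
  then obtain U V where "openin X U" "closedin X V" "x \<in> U" "U \<subseteq> V" "V \<subseteq> W"
    using assms unfolding neighbourhood_base_of by meson
  then show thesis using that[of U] closure_of_minimal[of U V X] by blast
qed

text \<open>If the returns \<open>s, t\<close> of \<open>x0\<close> to small neighbourhoods did not satisfy that \<open>s\<inverse> t x0\<close> is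
  close to \<open>x0\<close>, choose bad pairs \<open>s\<^sub>n, t\<^sub>n\<close> inductively and put \<open>\<beta>\<^sub>n = t\<^sub>0 \<cdots> t\<^sub>n\<^sub>-\<^sub>1 s\<^sub>n\<close>. For \<open>n < m\<close> the point
  \<open>\<beta>\<^sub>n\<inverse> \<beta>\<^sub>m x0 = s\<^sub>n\<inverse> t\<^sub>n (t\<^sub>n\<^sub>+\<^sub>1 \<cdots> t\<^sub>m\<^sub>-\<^sub>1 s\<^sub>m x0)\<close> is close to \<open>s\<^sub>n\<inverse> t\<^sub>n x0\<close>, so it stays away from \<open>x0\<close>, which
  contradicts almost automorphy.\<close>

lemma returns:
  assumes W: "openin X W" "x0 \<in> W"
  obtains W' where "openin X W'" "x0 \<in> W'"
    "\<And>s t z. \<phi> s x0 \<in> W' \<Longrightarrow> \<phi> t x0 \<in> W' \<Longrightarrow> z \<in> topspace X \<Longrightarrow> \<phi> s z = \<phi> t x0 \<Longrightarrow> z \<in> W"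
proof (rule ccontr)
  note * = that
  assume neg: "\<not> thesis"
  have bad: "\<exists>s t. \<phi> s x0 \<in> N \<and> \<phi> t x0 \<in> N \<and> (\<exists>z \<in> topspace X - W. \<phi> s z = \<phi> t x0)"
    if "openin X N" "x0 \<in> N" for N
  proof (rule ccontr)
    assume "\<not> ?thesis"
    then have "z \<in> W" if "\<phi> s x0 \<in> N" "\<phi> t x0 \<in> N" "z \<in> topspace X" "\<phi> s z = \<phi> t x0" for s t z
      using that by blast
    with *[OF that] neg show False by blast
  qed
  define st where "st = (\<lambda>N. SOME p. \<phi> (fst p) x0 \<in> N \<and> \<phi> (snd p) x0 \<in> N \<and>
      (\<exists>z \<in> topspace X - W. \<phi> (fst p) z = \<phi> (snd p) x0))"
  have st: "\<phi> (fst (st N)) x0 \<in> N \<and> \<phi> (snd (st N)) x0 \<in> N \<and>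
      (\<exists>z \<in> topspace X - W. \<phi> (fst (st N)) z = \<phi> (snd (st N)) x0)" if N: "openin X N" "x0 \<in> N" for N
    unfolding st_def by (rule someI_ex) (use bad[OF N] in simp)
  obtain V where V: "openin X V" "x0 \<in> V" "X closure_of V \<subseteq> W" using shrink[OF W] .
  \<comment> \<open>Openness of \<open>A\<close> keeps badness stable under perturbation; its
    closure, still missing \<open>x0\<close>, survives limits.\<close>
  define A where "A = topspace X - X closure_of V"
  have A: "openin X A" "A \<subseteq> topspace X" "topspace X - W \<subseteq> A"
    using V(3) by (auto simp: A_def)
  have "x0 \<notin> X closure_of A"
  proof
    assume "x0 \<in> X closure_of A"
    then obtain a where "a \<in> A" "a \<in> V" using V(1,2) unfolding in_closure_of by blast
    then show False
      using closure_of_subset[of V X] openin_subset[OF V(1)] unfolding A_def by blast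
  qed
  \<comment> \<open>Acting by \<open>t n\<close> leads from the next neighbourhood back into the
    current one, so products unwind factor by factor; the second condition keeps the failure of the
    pair \<open>s n\<close>, \<open>t n\<close>.\<close>
  define step where "step = (\<lambda>N. {x \<in> topspace X. \<phi> (snd (st N)) x \<in> N} \<inter>
      {x \<in> topspace X. \<phi> (snd (st N)) x \<in> \<phi> (fst (st N)) ` A})"
  define N where "N = (\<lambda>n. (step ^^ n) (topspace X))"
  define s t where "s = (\<lambda>n. fst (st (N n)))" and "t = (\<lambda>n. snd (st (N n)))"
  have N_Suc: "N (Suc n) = {x \<in> topspace X. \<phi> (t n) x \<in> N n} \<inter> {x \<in> topspace X. \<phi> (t n) x \<in> \<phi> (s n) ` A}" for n
    by (simp add: N_def step_def s_def t_def)
  have N: "openin X (N n) \<and> x0 \<in> N n" for n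
  proof (induction n)
    case 0
    show ?case by (simp add: N_def)
  next
    case (Suc n)
    then have "openin X (N (Suc n))"
      unfolding N_Suc using openin_continuous_map_preimage[OF cont] open_vimage[OF A(1)] by blast
    moreover have "x0 \<in> N (Suc n)"
    proof -
      obtain z where z: "z \<in> topspace X - W" "\<phi> (s n) z = \<phi> (t n) x0"
        using st[of "N n"] Suc unfolding s_def t_def by blast
      then have "\<phi> (t n) x0 \<in> \<phi> (s n) ` A" using A(3) by (metis imageI subsetD)
      then show ?thesis unfolding N_Suc using st[of "N n"] Suc by (simp add: t_def)
    qed
    ultimately show ?case ..
  qed
  have sN: "\<phi> (s n) x0 \<in> N n" for n using st[of "N n"] N by (simp add: s_def)
  define P where "P = rec_nat 1 (\<lambda>n p. p * t n)"
  have P_Suc: "P (Suc n) = P n * t n" for n by (simp add: P_def)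
  define b where "b = (\<lambda>n. P n * s n)"
  have tail: "\<phi> (P m) x \<in> \<phi> (b n) ` A" if "n < m" "x \<in> N m" for n m x
    using that
  proof (induction m arbitrary: x)
    case (Suc m)
    then have x: "x \<in> topspace X" "\<phi> (t m) x \<in> N m" "\<phi> (t m) x \<in> \<phi> (s m) ` A"
      unfolding N_Suc by auto
    have P: "\<phi> (P (Suc m)) x = \<phi> (P m) (\<phi> (t m) x)" using x by (simp add: P_Suc act_mult)
    show ?case
    proof (cases "n = m")
      case True
      obtain a where a: "a \<in> A" "\<phi> (t m) x = \<phi> (s m) a" using x(3) by blast
      then have "\<phi> (P (Suc m)) x = \<phi> (b n) a" using P A(2) True by (auto simp: b_def act_mult)
      with a show ?thesis by blast
    next
      case False
      then have "n < m" using Suc.prems by simp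
      from Suc.IH[OF this x(2)] show ?thesis using P by simp
    qed
  qed simp
  have late: "\<phi> (b m) x0 \<in> \<phi> (b n) ` A" if "n < m" for n m
    using tail[OF that sN] by (simp add: b_def act_mult)
  obtain y G where G: "G \<noteq> bot" "G \<le> sequentially" "limitin X (\<lambda>m. \<phi> (b m) x0) y G"
    using compact_space_cluster[OF compact trivial_limit_sequentially, of "\<lambda>m. \<phi> (b m) x0"]
      act_closed[OF base] by blast
  \<comment> \<open>With \<open>n\<close> fixed and \<open>m\<close> running along \<open>G\<close>,
    the limit \<open>y\<close> stays in the closed image of the closure of \<open>A\<close> under
    \<open>b n\<close>.\<close>
  have "\<exists>u. u \<in> X closure_of A \<and> \<phi> (b n) u = y" for n
  proof -
    have "eventually (\<lambda>m. n < m) G" using G(2) eventually_gt_at_top by (rule filter_leD)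
    moreover have "\<phi> (b n) ` A \<subseteq> \<phi> (b n) ` (X closure_of A)"
      using closure_of_subset[OF A(2)] by blast
    ultimately have "eventually (\<lambda>m. \<phi> (b m) x0 \<in> \<phi> (b n) ` (X closure_of A)) G"
      using late by (elim eventually_mono) blast
    then have "y \<in> \<phi> (b n) ` (X closure_of A)"
      using limitin_closedin[OF G(3) closed_act[OF closedin_closure_of]] G(1) by blast
    then show ?thesis by blast
  qed
  then obtain u where u: "\<And>n. u n \<in> X closure_of A" "\<And>n. \<phi> (b n) (u n) = y" by metis
  have uX: "u n \<in> topspace X" for n using closure_of_subset_topspace u(1) by (rule subsetD)
  obtain x' H where H: "H \<noteq> bot" "H \<le> G" "limitin X u x' H"
    using compact_space_cluster[OF compact G(1), of u] uX by blast
  have "x0 = x'"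
    using almost_automorphic_point_net[OF aa H(1) uX limitin_filter_mono[OF G(3) H(2)] H(3) u(2)] .
  moreover have "x' \<in> X closure_of A"
    using limitin_closedin[OF H(3) closedin_closure_of] u(1) H(1) by simp
  ultimately show False using \<open>x0 \<notin> X closure_of A\<close> by simp
qed

text \<open>The same with \<open>s, t\<close> replaced by \<open>a\<inverse> b\<close> and \<open>a\<inverse> c\<close>: by minimality some \<open>r\<close> returns \<open>a x0\<close> so close to
  \<open>x0\<close> that \<open>r b\<close> and \<open>r c\<close> approximate them.\<close>

lemma returns_fractions:
  assumes W: "openin X W" "x0 \<in> W"
  obtains W' where "openin X W'" "x0 \<in> W'"
    "\<And>a b c z. \<phi> b x0 \<in> \<phi> a ` W' \<Longrightarrow> \<phi> c x0 \<in> \<phi> a ` W' \<Longrightarrow> z \<in> topspace X \<Longrightarrow>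
      \<phi> b z = \<phi> c x0 \<Longrightarrow> z \<in> W"
proof -
  obtain W' where W': "openin X W'" "x0 \<in> W'" and
    ret: "\<And>s t z. \<phi> s x0 \<in> W' \<Longrightarrow> \<phi> t x0 \<in> W' \<Longrightarrow> z \<in> topspace X \<Longrightarrow> \<phi> s z = \<phi> t x0 \<Longrightarrow> z \<in> W"
    using returns[OF W] by blast
  have W'X: "W' \<subseteq> topspace X" using W'(1) by (rule openin_subset)
  have "z \<in> W" if b: "\<phi> b x0 \<in> \<phi> a ` W'" and c: "\<phi> c x0 \<in> \<phi> a ` W'" and z: "z \<in> topspace X" "\<phi> b z = \<phi> c x0"
    for a b c z
  proof -
    let ?N = "{x \<in> topspace X. \<phi> b x \<in> \<phi> a ` W'} \<inter> {x \<in> topspace X. \<phi> c x \<in> \<phi> a ` W'}"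
    have "openin X ?N" using open_vimage[OF W'(1)] by blast
    moreover have "x0 \<in> ?N" using b c by simp
    ultimately obtain r where "\<phi> r (\<phi> a x0) \<in> ?N"
      by (rule minimal_flow_meets[OF min act_closed[OF base]])
    then have r: "\<phi> b (\<phi> r (\<phi> a x0)) \<in> \<phi> a ` W'" "\<phi> c (\<phi> r (\<phi> a x0)) \<in> \<phi> a ` W'" by simp_all
    \<comment> \<open>Commutativity brings \<open>a\<close> to the outside, where injectivity
      cancels it against the image of \<open>W'\<close>.\<close>
    have swap: "\<phi> d (\<phi> r (\<phi> a x0)) = \<phi> a (\<phi> (r * d) x0)" for d
    proof -
      have "\<phi> d (\<phi> r (\<phi> a x0)) = \<phi> d (\<phi> a (\<phi> r x0))" by (simp only: act_commute[OF base, of r a])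
      also have "\<dots> = \<phi> a (\<phi> d (\<phi> r x0))" by (simp add: act_commute[of _ d a])
      also have "\<dots> = \<phi> a (\<phi> (r * d) x0)" by (simp add: act_mult comm[of d r])
      finally show ?thesis .
    qed
    have "\<phi> (r * b) x0 \<in> W'" "\<phi> (r * c) x0 \<in> W'"
      using r unfolding swap by (simp_all add: act_image_iff[OF W'X])
    moreover have "\<phi> (r * b) z = \<phi> (r * c) x0" using z by (simp flip: act_mult)
    ultimately show ?thesis using ret z(1) by blast
  qed
  with W' show thesis by (rule that)
qed

section \<open>The invariant uniformity\<close>

text \<open>In terms of the group generated by the transitions: some \<open>t\<inverse> s\<close> maps both points into \<open>W\<close>.\<close>

definition close_pairs :: "'x set \<Rightarrow> ('x \<times> 'x) set" where
  "close_pairs W = {(x, x'). x \<in> topspace X \<and> x' \<in> topspace X \<and>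
     (\<exists>s t. \<phi> s x \<in> \<phi> t ` W \<and> \<phi> s x' \<in> \<phi> t ` W)}"

lemma close_pairs_mono: "V \<subseteq> W \<Longrightarrow> close_pairs V \<subseteq> close_pairs W"
  unfolding close_pairs_def by blast

lemma sym_close_pairs: "sym (close_pairs W)"
  unfolding close_pairs_def sym_def by blast

lemma openin_close_pairs:
  assumes W: "openin X W"
  shows "openin (prod_topology X X) (close_pairs W)"
proof -
  let ?U = "\<lambda>(s, t). {x \<in> topspace X. \<phi> s x \<in> \<phi> t ` W}"
  have "openin (prod_topology X X) (\<Union>p. ?U p \<times> ?U p)"
    using open_vimage[OF W] by (intro openin_Union) (auto simp: openin_prod_Times_iff)
  moreover have "close_pairs W = (\<Union>p. ?U p \<times> ?U p)"
    unfolding close_pairs_def by auto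
  ultimately show ?thesis by simp
qed

lemma close_pairs_refl:
  assumes W: "openin X W" "x0 \<in> W" and x: "x \<in> topspace X"
  shows "(x, x) \<in> close_pairs W"
proof -
  obtain s where "\<phi> s x \<in> W" using minimal_flow_meets[OF min x W] .
  moreover have "\<phi> 1 ` W = W"
    using openin_subset[OF W(1)] semiflowD(5)[OF flow] by force
  ultimately have "\<phi> s x \<in> \<phi> 1 ` W" by simp
  with x show ?thesis unfolding close_pairs_def by blast
qed

text \<open>Replacing \<open>s\<close> by \<open>s * r\<close> or \<open>t\<close> by
  \<open>r * t\<close> multiplies the fraction \<open>t^-1 s\<close> by \<open>r\<close> or by its
  inverse.\<close>

lemma close_pairs_act:
  assumes W: "W \<subseteq> topspace X" and x: "x \<in> topspace X" "x' \<in> topspace X"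
  shows "(\<phi> r x, \<phi> r x') \<in> close_pairs W \<longleftrightarrow> (x, x') \<in> close_pairs W"
proof
  assume "(\<phi> r x, \<phi> r x') \<in> close_pairs W"
  then obtain s t where "\<phi> (s * r) x \<in> \<phi> t ` W" "\<phi> (s * r) x' \<in> \<phi> t ` W"
    using x unfolding close_pairs_def by (auto simp: act_mult)
  with x show "(x, x') \<in> close_pairs W" unfolding close_pairs_def by blast
next
  assume "(x, x') \<in> close_pairs W"
  then obtain s t where st: "\<phi> s x \<in> \<phi> t ` W" "\<phi> s x' \<in> \<phi> t ` W"
    unfolding close_pairs_def by blast
  have "\<phi> s (\<phi> r z) \<in> \<phi> (r * t) ` W" if z: "z \<in> topspace X" "\<phi> s z \<in> \<phi> t ` W" for z
  proof -
    obtain w where w: "w \<in> W" "\<phi> s z = \<phi> t w" using z(2) by blast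
    have "\<phi> s (\<phi> r z) = \<phi> r (\<phi> t w)" using act_commute[OF z(1)] w(2) by simp
    also have "\<dots> = \<phi> (r * t) w" using w(1) W by (intro act_mult) blast
    finally show ?thesis using w(1) by blast
  qed
  then show "(\<phi> r x, \<phi> r x') \<in> close_pairs W"
    using st x unfolding close_pairs_def by simp blast
qed

text \<open>With \<open>g = a^-1 s\<close>: if \<open>g\<close> moves both \<open>x\<close> and
  \<open>k x0\<close> into \<open>W'\<close>, then \<open>k^-1 x\<close> lies in \<open>W\<close>.
  This one condition yields both the composition law and separation from \<open>x0\<close>.\<close>

definition refines :: "'x set \<Rightarrow> 'x set \<Rightarrow> bool" where
  "refines W' W \<longleftrightarrow> openin X W' \<and> x0 \<in> W' \<and>
     (\<forall>s a k x. x \<in> topspace X \<longrightarrow> \<phi> s x \<in> \<phi> a ` W' \<longrightarrow> \<phi> s (\<phi> k x0) \<in> \<phi> a ` W' \<longrightarrow> x \<in> \<phi> k ` W)"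

text \<open>For \<open>x = \<phi> l x0\<close> this is \<open>returns_fractions\<close> with the
  elements \<open>s * k\<close> and \<open>s * l\<close>. Density of the orbit extends it to all
  \<open>x\<close> at the price of a closure, hence the smaller set \<open>V\<close>.\<close>

lemma refinement:
  assumes W: "openin X W" "x0 \<in> W"
  obtains W' where "refines W' W"
proof -
  obtain V where V: "openin X V" "x0 \<in> V" "X closure_of V \<subseteq> W" using shrink[OF W] .
  obtain W' where W': "openin X W'" "x0 \<in> W'" and
    ret: "\<And>a b c z. \<phi> b x0 \<in> \<phi> a ` W' \<Longrightarrow> \<phi> c x0 \<in> \<phi> a ` W' \<Longrightarrow> z \<in> topspace X \<Longrightarrow>
      \<phi> b z = \<phi> c x0 \<Longrightarrow> z \<in> V"
    using returns_fractions[OF V(1,2)] by blast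
  have "x \<in> \<phi> k ` W" if x: "x \<in> topspace X" "\<phi> s x \<in> \<phi> a ` W'" and k: "\<phi> s (\<phi> k x0) \<in> \<phi> a ` W'" for s a k x
  proof -
    have orbit: "\<phi> l x0 \<in> \<phi> k ` V" if l: "\<phi> s (\<phi> l x0) \<in> \<phi> a ` W'" for l
    proof -
      obtain z where z: "z \<in> topspace X" "\<phi> k z = \<phi> l x0" by (rule preimage[of "\<phi> l x0" k]) simp_all
      then have "\<phi> (s * k) z = \<phi> (s * l) x0" by (simp flip: act_mult)
      then have "z \<in> V" using ret[of "s * k" a "s * l" z] k l z(1) by (simp add: act_mult)
      then show ?thesis using z(2) by (metis imageI)
    qed
    let ?C = "\<phi> k ` (X closure_of V)"
    have VC: "\<phi> k ` V \<subseteq> ?C" using closure_of_subset[OF openin_subset[OF V(1)]] by blast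
    have "x \<in> ?C"
    proof (rule ccontr)
      assume "x \<notin> ?C"
      let ?O = "{x \<in> topspace X. \<phi> s x \<in> \<phi> a ` W'} - ?C"
      have "openin X ?O" by (intro openin_diff open_vimage W' closed_act closedin_closure_of)
      moreover have "x \<in> ?O" using x \<open>x \<notin> ?C\<close> by simp
      ultimately obtain l where "\<phi> l x0 \<in> ?O" by (rule minimal_flow_meets[OF min base])
      with orbit VC show False by blast
    qed
    then show ?thesis using V(3) by blast
  qed
  then have "refines W' W" unfolding refines_def using W' by blast
  then show thesis by (rule that)
qed

text \<open>The middle point may be moved within an open set to an orbit point
  \<open>\<phi> k x0\<close>; then \<open>k^-1\<close> carries both outer points into
  \<open>W\<close>.\<close>

lemma close_pairs_compose:
  assumes ref: "refines W' W"
  shows "close_pairs W' O close_pairs W' \<subseteq> close_pairs W"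
proof clarify
  fix x x' x'' assume "(x, x') \<in> close_pairs W'" "(x', x'') \<in> close_pairs W'"
  then obtain s a r b where x: "x \<in> topspace X" "x' \<in> topspace X" "x'' \<in> topspace X"
    and sa: "\<phi> s x \<in> \<phi> a ` W'" "\<phi> s x' \<in> \<phi> a ` W'"
    and rb: "\<phi> r x' \<in> \<phi> b ` W'" "\<phi> r x'' \<in> \<phi> b ` W'"
    unfolding close_pairs_def by blast
  have W': "openin X W'" and
    step: "\<And>s a k x. x \<in> topspace X \<Longrightarrow> \<phi> s x \<in> \<phi> a ` W' \<Longrightarrow> \<phi> s (\<phi> k x0) \<in> \<phi> a ` W' \<Longrightarrow> x \<in> \<phi> k ` W"
    using ref unfolding refines_def by blast+
  let ?N = "{x \<in> topspace X. \<phi> s x \<in> \<phi> a ` W'} \<inter> {x \<in> topspace X. \<phi> r x \<in> \<phi> b ` W'}"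
  have "openin X ?N" using open_vimage[OF W'] by blast
  moreover have "x' \<in> ?N" using x sa rb by simp
  ultimately obtain k where "\<phi> k x0 \<in> ?N" by (rule minimal_flow_meets[OF min base])
  then have "x \<in> \<phi> k ` W" "x'' \<in> \<phi> k ` W" using step x sa rb by simp_all
  moreover have "\<phi> 1 x = x" "\<phi> 1 x'' = x''" using x semiflowD(5)[OF flow] by simp_all
  ultimately have "\<phi> 1 x \<in> \<phi> k ` W" "\<phi> 1 x'' \<in> \<phi> k ` W" by simp_all
  then show "(x, x'') \<in> close_pairs W" unfolding close_pairs_def using x by blast
qed

text \<open>The case \<open>k = 1\<close> of \<open>refines\<close>. Applied to the complement of a
  point, it separates that point from \<open>x0\<close> in the quotient.\<close>

lemma close_pairs_base:
  assumes ref: "refines W' W" and WX: "W \<subseteq> topspace X" and x: "(x0, x) \<in> close_pairs W'"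
  shows "x \<in> W"
proof -
  obtain s a where x: "x \<in> topspace X" "\<phi> s x0 \<in> \<phi> a ` W'" "\<phi> s x \<in> \<phi> a ` W'"
    using x unfolding close_pairs_def by blast
  have one: "\<phi> 1 z = z" if "z \<in> topspace X" for z using that semiflowD(5)[OF flow] by simp
  have "\<phi> s (\<phi> 1 x0) \<in> \<phi> a ` W'" using x(2) one by simp
  then have "x \<in> \<phi> 1 ` W" using ref x unfolding refines_def by blast
  then show ?thesis using one WX by auto
qed

lemma almost_one_one_extension_exists:
  "\<exists>(Y :: 'x topology) \<psi> \<pi>. almost_one_one_extension X \<phi> Y \<psi> \<pi> \<and>
     equicontinuous_flow Y \<psi> \<and> invertible_flow Y \<psi>"
proof -
  define \<W> where "\<W> = {W. openin X W \<and> x0 \<in> W}"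
  let ?\<E> = "close_pairs ` \<W>"
  have WX: "W \<subseteq> topspace X" if "W \<in> \<W>" for W using that by (simp add: \<W>_def openin_subset)
  have compose: "\<exists>E'\<in>?\<E>. E' O E' \<subseteq> E" if E: "E \<in> ?\<E>" for E
  proof -
    obtain W where W: "W \<in> \<W>" "E = close_pairs W" using E by blast
    obtain W' where W': "refines W' W" using refinement[of W] W(1) unfolding \<W>_def by blast
    then have "W' \<in> \<W>" unfolding refines_def \<W>_def by simp
    with close_pairs_compose[OF W'] W(2) show ?thesis by blast
  qed
  have directed: "\<exists>E''\<in>?\<E>. E'' \<subseteq> E \<inter> E'" if E: "E \<in> ?\<E>" "E' \<in> ?\<E>" for E E'
  proof -
    obtain W W' where W: "W \<in> \<W>" "E = close_pairs W" "W' \<in> \<W>" "E' = close_pairs W'" using E by blast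
    then have "W \<inter> W' \<in> \<W>" by (simp add: \<W>_def openin_Int)
    moreover have "close_pairs (W \<inter> W') \<subseteq> E \<inter> E'"
      using W close_pairs_mono[of "W \<inter> W'" W] close_pairs_mono[of "W \<inter> W'" W'] by simp
    ultimately show ?thesis by blast
  qed
  have "topspace X \<in> \<W>" by (simp add: \<W>_def)
  then have nonempty: "?\<E> \<noteq> {}" by blast
  have opens: "openin (prod_topology X X) E" if "E \<in> ?\<E>" for E
    using that openin_close_pairs by (auto simp: \<W>_def)
  have refl: "(x, x) \<in> E" if "E \<in> ?\<E>" "x \<in> topspace X" for E x
    using that close_pairs_refl by (auto simp: \<W>_def)
  have sym: "sym E" if "E \<in> ?\<E>" for E using that sym_close_pairs by blast
  have invariant: "(\<phi> t x, \<phi> t x') \<in> E \<longleftrightarrow> (x, x') \<in> E"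
    if E: "E \<in> ?\<E>" and x: "x \<in> topspace X" "x' \<in> topspace X" for E x x' t
  proof -
    obtain W where "W \<in> \<W>" "E = close_pairs W" using E by blast
    then show ?thesis using close_pairs_act[OF WX] x by simp
  qed
  obtain Y :: "'x topology" and \<psi> \<pi> where Y: "semiflow Y \<psi>" "minimal_flow Y \<psi>"
    and epi: "epimorphism X \<phi> Y \<psi> \<pi>"
    and eq: "equicontinuous_flow Y \<psi>" "invertible_flow Y \<psi>"
    and fib: "\<And>x x'. x \<in> topspace X \<Longrightarrow> x' \<in> topspace X \<Longrightarrow> \<pi> x = \<pi> x' \<longleftrightarrow> (x, x') \<in> \<Inter>?\<E>"
    using equicontinuous_quotient[OF flow min surj nonempty opens refl sym directed compose invariant]
    by blast
  have "x = x0" if x: "x \<in> topspace X" "\<pi> x = \<pi> x0" for x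
  proof (rule ccontr)
    assume "x \<noteq> x0"
    let ?W = "topspace X - {x}"
    have W: "openin X ?W" using closedin_Hausdorff_singleton[OF Hausdorff x(1)] by blast
    obtain W' where W': "refines W' ?W" using refinement[OF W] \<open>x \<noteq> x0\<close> by auto
    then have "W' \<in> \<W>" unfolding refines_def \<W>_def by simp
    moreover have "(x0, x) \<in> \<Inter>?\<E>" using fib[OF base x(1)] x(2) by simp
    ultimately have "(x0, x) \<in> close_pairs W'" by blast
    then have "x \<in> ?W" using close_pairs_base[OF W'] by blast
    then show False by simp
  qed
  then have "fibre X \<pi> (\<pi> x0) = {x0}" unfolding fibre_def by auto
  moreover have "\<pi> x0 \<in> topspace Y" using epi base unfolding epimorphism_def by blast
  ultimately have "almost_one_one_extension X \<phi> Y \<psi> \<pi>"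
    unfolding almost_one_one_extension_def using flow min Y epi by blast
  with eq show ?thesis by blast
qed

end

text \<open>The factor can be sought on \<open>'x\<close> because it is realised on representatives;
  the additional clause gives the converse for factors on any type \<open>'y\<close>.\<close>

theorem theorem5p9:
  fixes X :: "'x topology" and \<phi> :: "'t::topological_monoid_mult \<Rightarrow> 'x \<Rightarrow> 'x"
  assumes "semiflow X \<phi>"
  shows
    "(minimal_flow X \<phi> \<and> (\<forall>s t :: 't. s * t = t * s) \<and> (\<forall>t. fibre_continuous X (\<phi> t)) \<longrightarrow>
        (almost_automorphic X \<phi> \<longleftrightarrow>
           (\<exists>(Y :: 'x topology) \<psi> \<pi>. almost_one_one_extension X \<phi> Y \<psi> \<pi> \<and>
              equicontinuous_flow Y \<psi> \<and> invertible_flow Y \<psi>)) \<and>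
        (\<forall>(Y :: 'y topology) \<psi> \<pi>. almost_one_one_extension X \<phi> Y \<psi> \<pi> \<and>
              equicontinuous_flow Y \<psi> \<and> invertible_flow Y \<psi> \<longrightarrow> almost_automorphic X \<phi>)) \<and>
     (\<forall>(Y :: 'y topology) \<psi> \<pi>. almost_one_one_extension X \<phi> Y \<psi> \<pi> \<and> point_distal X \<phi> \<longrightarrow>
        (\<forall>x. distal_point X \<phi> x \<longrightarrow> fibre X \<pi> (\<pi> x) = {x}))"
proof (intro conjI impI allI iffI; (elim conjE exE)?)
  assume "minimal_flow X \<phi>" "\<forall>s t :: 't. s * t = t * s" "\<forall>t. fibre_continuous X (\<phi> t)"
    and "almost_automorphic X \<phi>"
  then obtain x0 where "almost_automorphic_semiflow X \<phi> x0"
    using assms unfolding almost_automorphic_semiflow_def almost_automorphic_def by blast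
  then show "\<exists>(Y :: 'x topology) \<psi> \<pi>. almost_one_one_extension X \<phi> Y \<psi> \<pi> \<and>
      equicontinuous_flow Y \<psi> \<and> invertible_flow Y \<psi>"
    by (rule almost_automorphic_semiflow.almost_one_one_extension_exists)
qed (erule (2) almost_automorphic_if_extension | erule (1) almost_one_one_extension_distal_point)+

end
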